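(* Let $B^0$ be an $n\times n$ skew-symmetrizable integer matrix, $D=\mathrm{diag}(d_1,\dots,d_n)$ a diagonal matrix with positive integer diagonal entries such that $DB^0$ is skew-symmetric, $t_0\in\mathbb{T}_n$, $\Lambda$ an $n\times n$ skew-symmetric integer matrix and $\mathcal{A}_\bullet=\mathcal{A}_\bullet(B^0,D,\Lambda,t_0)$. The quantum $F$-polynomials $F_{j;t}=F_{j;t}^{B^0;D;t_0}$ are given by the following recurrence relations. Initial values: $F_{j;t_0}=1$ for $j\in[1,n]$. Suppose $t\overset{k}{-}t'$ in $\mathbb{T}_n$. Then $F_{j;t'}=F_{j;t}$ if $j\ne k$. For $F_{k;t'}$, let $\tilde B^t=(b_{ij})$ be the $2n\times n$ exchange matrix of $\mathcal{A}_\bullet$ at $t$. For $j\in[1,n]$, $j\neq k$, and $\epsilon\in\{+,-\}$ put $$G_j^{(\epsilon)}=\prod_{i=1}^{[\epsilon b_{jk}]_+}L[(i-1)\mathbf{g}_{j;t}](F_{j;t})\quad(\text{factors in increasing order of } i \text{ from left to right; equal to }1\text{ if }\epsilon b_{jk}\le0),$$ $$\hat F_{j;t}^{\{[\epsilon b_{jk}]_+\}}=L\Big[-\mathbf{g}_{k;t}+\sum_{i=1}^{j-1}[\epsilon b_{ik}]_+\mathbf{g}_{i;t}\Big](G_j^{(\epsilon)}),$$ put $\hat F_{k;t}^{\{[\epsilon b_{kk}]_+\}}=1$ and $\hat F_{k;t}^{\{-1\}}=(L[-\mathbf{g}_{k;t}](F_{k;t}))^{-1}$. Let $$\rho^\epsilon=\tfrac12\Big(-\sum_{i=1}^{2n}[\epsilon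 b_{ik}]_+\rho^t_{ik}+\sum_{1\le i<j\le n}[\epsilon b_{ik}]_+[\epsilon b_{jk}]_+\rho^t_{ji}+\sum_{1\le i,j\le n}[\epsilon b_{ik}]_+[\epsilon b_{n+j,k}]_+\rho^t_{n+j,i}\Big),$$ $$\lambda^\epsilon=\tfrac12\sum_{i=1}^n[\epsilon b_{n+i,k}]_+\,g_i'\,d_i,\qquad\text{where }\mathbf{g}_{k;t'}=(g_1',\dots,g_n').$$ Then $$F_{k;t'}=q^{\rho^+-\lambda^+}\hat F_{k;t}^{\{-1\}}\Big(\prod_{i=1}^n\hat F_{i;t}^{\{[b_{ik}]_+\}}\Big)Z^{\sum_{\ell=1}^n[b_{n+\ell,k}]_+\mathbf{e}_\ell}+q^{\rho^--\lambda^-}\hat F_{k;t}^{\{-1\}}\Big(\prod_{i=1}^n\hat F_{i;t}^{\{[-b_{ik}]_+\}}\Big)Z^{\sum_{\ell=1}^n[-b_{n+\ell,k}]_+\mathbf{e}_\ell},$$ where products over $i\in[1,n]$ are taken in increasing order of $i$ from left to right, and the identity holds in the skew-field of fractions of the quantum torus generated by $Z_1^{\pm1},\dots,Z_n^{\pm1}$.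
   Context: Notation: $[i,j]=\{k\in\mathbb{Z}: i\le k\le j\}$; $[x]_+=\max(x,0)$; $\mathbf{e}_i$ are standard basis vectors. $\mathbb{T}_n$ is the $n$-regular tree with edges labeled by $1,\dots,n$ so that the $n$ edges at each vertex have distinct labels; $t\overset{k}{-}t'$ means $t,t'$ are joined by an edge labeled $k$. Mutation of an $m\times n$ integer matrix $\tilde B=(b_{ij})$ in direction $k\in[1,n]$: $b'_{ij}=-b_{ij}$ if $i=k$ or $j=k$, and $b'_{ij}=b_{ij}+\mathrm{sgn}(b_{ik})[b_{ik}b_{kj}]_+$ otherwise. $\mathbf{g}$-vectors. Consider the classical cluster pattern with principal coefficients at $t_0$: the initial extended cluster is $(x_1,\dots,x_n,y_1,\dots,y_n)$, the initial exchange matrix is $\left(\begin{smallmatrix}B^0\\ I\end{smallmatrix}\right)$, and mutation of a seed $((x_1,\dots,x_m),\tilde B)$ in direction $k$ mutates $\tilde B$ and replaces only $x_k$, by $x_k'=x_k^{-1}(\prod_i x_i^{[b_{ik}]_+}+\prod_i x_i^{[-b_{ik}]_+})$; seeds at vertices of $\mathbb{T}_n$ joined by an edge labeled $k$ are related by mutation in direction $k$. The cluster variable $x_{j;t}$ lies in $\mathbb{Z}[x_1^{\pm1},\dots,x_n^{\pm1},y_1,\dots,y_n]$ and is homogeneous for the $\mathbb{Z}^n$-grading $\deg x_i=\mathbf{e}_i$, $\deg y_i=-(\text{$i$th column of }B^0)$; its degree is the $\mathbf{g}$-vector $\mathbf{g}_{j;t}=\mathbf{g}_{j;t}^{B^0;t_0}$.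 Vectors in $\mathbb{Z}^n$ are regarded as vectors in $\mathbb{Z}^{2n}$ by appending zeros; for $j\in[n+1,2n]$ put $\mathbf{g}_{j;t}=\mathbf{e}_j\in\mathbb{Z}^{2n}$. Quantum cluster algebras. Let $L$ be a rank $m$ lattice with skew-symmetric form $\Lambda_L:L\times L\to\mathbb{Z}$; the based quantum torus is the $\mathbb{Z}[q^{\pm1/2}]$-algebra with basis $\{X^e:e\in L\}$ and $X^eX^f=q^{\Lambda_L(e,f)/2}X^{e+f}$; $\mathcal{F}$ is its skew-field of fractions. A toric frame is a map $M:\mathbb{Z}^m\to\mathcal{F}\setminus\{0\}$, $M(\mathbf c)=\varphi(X^{\eta(\mathbf c)})$, with $\varphi$ an automorphism of $\mathcal{F}$ (fixing $q^{1/2}$) and $\eta:\mathbb{Z}^m\to L$ a lattice isomorphism; $\Lambda_M$ is the form on $\mathbb{Z}^m$ transferred by $\eta$ (also its matrix), so $M(\mathbf c)M(\mathbf d)=q^{\Lambda_M(\mathbf c,\mathbf d)/2}M(\mathbf c+\mathbf d)$. A quantum seed is a pair $(M,\tilde B)$ with $\tilde B^T\Lambda_M=(D|0)$. Its mutation in direction $k$ is $(M',\tilde B')$, where $\tilde B'$ is the matrix mutation and $M'$ is the toric frame determined by $M'(\mathbf{e}_i)=M(\mathbf{e}_i)$ for $i\ne k$ and $M'(\mathbf{e}_k)=M(-\mathbf{e}_k+\sum_{i=1}^m[b_{ik}]_+\mathbf{e}_i)+M(-\mathbf{e}_k+\sum_{i=1}^m[-b_{ik}]_+\mathbf{e}_i)$;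 this is again a quantum seed with the same $D$. A quantum cluster pattern assigns quantum seeds $(M_t,\tilde B^t)$ to $t\in\mathbb{T}_n$ compatibly with mutations; $X_{j;t}=M_t(\mathbf{e}_j)$, $\Lambda_t=\Lambda_{M_t}$, $M_0=M_{t_0}$, $\Lambda_0=\Lambda_{t_0}$, $\hat Y_j=M_0(\tilde{\mathbf b}^j)$ with $\tilde{\mathbf b}^j$ the $j$th column of $\tilde B^{t_0}$. $\mathcal{A}_\bullet(B^0,D,\Lambda,t_0)$ is the quantum cluster algebra with $m=2n$, initial matrix $\left(\begin{smallmatrix}B^0\\ I\end{smallmatrix}\right)$ and the unique $2n\times2n$ skew-symmetric $\Lambda_0$ with $(\tilde B^{t_0})^T\Lambda_0=(D|0)$ whose upper left $n\times n$ block is $\Lambda$. In $\mathcal{A}_\bullet$ put $\rho^t_{ij}=\Lambda_t(\mathbf{e}_i,\mathbf{e}_j)-\Lambda_0(\mathbf{g}_{i;t},\mathbf{g}_{j;t})$ for $i,j\in[1,2n]$. $\mathcal{R}$ is the quantum torus over $\mathbb{Z}[q^{\pm1/2}]$ generated by $Z_1^{\pm1},\dots,Z_n^{\pm1}$ with $Z_iZ_j=q^{d_ib^0_{ij}}Z_jZ_i$, $B^0=(b^0_{ij})$; for $\mathbf c\in\mathbb{Z}^n$, $Z^{\mathbf c}=q^{\frac12\sum_{1\le i<j\le n}d_jb^0_{ji}c_ic_j}Z_1^{c_1}\cdots Z_n^{c_n}$. $F(\hat Y)$ denotes substitution $Z_i\mapsto\hat Y_i$. The quantum $F$-polynomial $F_{j;t}=F_{j;t}^{B^0;D;t_0}$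 is the unique polynomial in $Z_1,\dots,Z_n$ with coefficients in $\mathbb{Z}[q^{\pm1/2}]$ such that $X_{j;t}=F_{j;t}(\hat Y)M_0(\mathbf{g}_{j;t})$ in $\mathcal{A}_\bullet$ (it exists and does not depend on $\Lambda$). For $\mathbf a=(a_1,\dots,a_n)\in\mathbb{Z}^n$, $L[\mathbf a]:\mathcal{R}\to\mathcal{R}$ is the $\mathbb{Z}[q^{\pm1/2}]$-linear operator with $L[\mathbf a](Z^{\mathbf b})=q^{-\sum_{i=1}^na_ib_id_i}Z^{\mathbf b}$ for all $\mathbf b\in\mathbb{Z}^n$. *)

theory Defs
  imports Complex_Main "HOL-Library.Poly_Mapping" "HOL-Computational_Algebra.Fraction_Field"
begin

section \<open>Integer vectors, matrix mutation and the labelled regular tree\<close>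

text \<open>
  All indices are 1-based natural numbers. Vectors of \<open>\<int>\<^sup>m\<close> are finitely supported functions whose
  support lies in \<open>{1..m}\<close>; hence \<open>\<int>\<^sup>n \<subseteq> \<int>\<^sup>m\<close> for \<open>n \<le> m\<close> by appending zeros, with no coercion.
  Matrices are functions \<open>nat \<Rightarrow> nat \<Rightarrow> int\<close> of which only the entries in range matter.
\<close>

type_synonym ivec = "nat \<Rightarrow>\<^sub>0 int"

type_synonym imat = "nat \<Rightarrow> nat \<Rightarrow> int"

definition zvecs :: "nat \<Rightarrow> ivec set" where
  "zvecs m = {c. Poly_Mapping.keys c \<subseteq> {1..m}}"

abbreviation unit_vec :: "nat \<Rightarrow> ivec" where
  "unit_vec i \<equiv> Poly_Mapping.single i 1"

definition vscale :: "int \<Rightarrow> ivec \<Rightarrow> ivec" where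
  "vscale s c = Poly_Mapping.map ((*) s) c"

definition pos_part :: "int \<Rightarrow> int" where
  "pos_part x = max x 0"

definition mutate_entry :: "nat \<Rightarrow> imat \<Rightarrow> imat" where
  "mutate_entry k b = (\<lambda>i j. if i = k \<or> j = k then - b i j
                             else b i j + sgn (b i k) * pos_part (b i k * b k j))"

definition matrix_mutation :: "nat \<Rightarrow> nat \<Rightarrow> nat \<Rightarrow> imat \<Rightarrow> imat \<Rightarrow> bool" where
  "matrix_mutation m n k b b' \<longleftrightarrow> (\<forall>i\<in>{1..m}. \<forall>j\<in>{1..n}. b' i j = mutate_entry k b i j)"

text \<open>The \<open>2n \<times> n\<close> matrix with upper block \<open>B0\<close> and lower block the identity.\<close>

definition is_principal_matrix :: "nat \<Rightarrow> imat \<Rightarrow> imat \<Rightarrow> bool" where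
  "is_principal_matrix n B0 b \<longleftrightarrow>
     (\<forall>i\<in>{1..n}. \<forall>j\<in>{1..n}. b i j = B0 i j \<and> b (n + i) j = (if i = j then 1 else 0))"

text \<open>
  The \<open>n\<close>-regular tree, realised as the Cayley graph of the free product of \<open>n\<close> copies of \<open>\<int>/2\<close>:
  vertices are the words over \<open>{1..n}\<close> without two equal adjacent letters, and the edge labelled
  \<open>k\<close> at a word either adds or removes a leading letter \<open>k\<close>.
\<close>

definition tree_vertices :: "nat \<Rightarrow> nat list set" where
  "tree_vertices n = {t. set t \<subseteq> {1..n} \<and> distinct_adj t}"

definition tree_edge :: "nat \<Rightarrow> nat \<Rightarrow> nat list \<Rightarrow> nat list \<Rightarrow> bool" where
  "tree_edge n k t t' \<longleftrightarrow> k \<in> {1..n} \<and> t \<in> tree_vertices n \<and> t' \<in> tree_vertices n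
     \<and> (t' = k # t \<or> t = k # t')"

section \<open>Classical cluster pattern with principal coefficients and g-vectors\<close>

text \<open>
  The Laurent polynomials over \<open>\<int>\<close> in variables \<open>x\<^sub>1, x\<^sub>2, \<dots>\<close>, as the group ring of the exponent
  vectors (the product is convolution). The variable \<open>y\<^sub>i\<close> is \<open>x\<^bsub>n+i\<^esub>\<close>.
\<close>

type_synonym laurent = "ivec \<Rightarrow>\<^sub>0 int"

definition laurent_fract :: "laurent \<Rightarrow> laurent fract" where
  "laurent_fract P = Fraction_Field.Fract P 1"

definition classical_principal_pattern ::
    "nat \<Rightarrow> imat \<Rightarrow> nat list \<Rightarrow> (nat list \<Rightarrow> nat \<Rightarrow> laurent fract) \<Rightarrow> (nat list \<Rightarrow> imat) \<Rightarrow> bool" where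
  "classical_principal_pattern n B0 t0 x b \<longleftrightarrow>
     (\<forall>i\<in>{1..2*n}. x t0 i = laurent_fract (Poly_Mapping.single (unit_vec i) 1))
   \<and> is_principal_matrix n B0 (b t0)
   \<and> (\<forall>k t t'. tree_edge n k t t' \<longrightarrow>
        matrix_mutation (2*n) n k (b t) (b t')
      \<and> (\<forall>i\<in>{1..2*n}. i \<noteq> k \<longrightarrow> x t' i = x t i)
      \<and> x t' k = inverse (x t k) *
          ((\<Prod>i\<in>{1..2*n}. x t i powi pos_part (b t i k))
         + (\<Prod>i\<in>{1..2*n}. x t i powi pos_part (- b t i k))))"

text \<open>
  \<open>\<int>\<^sup>n\<close>-degree of the monomial with exponent vector \<open>c\<close>, where \<open>deg x\<^sub>i\<close> is the \<open>i\<close>th unit vector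
  and \<open>deg y\<^sub>i\<close> is minus the \<open>i\<close>th column of \<open>B0\<close>.
\<close>

definition monomial_degree :: "nat \<Rightarrow> imat \<Rightarrow> ivec \<Rightarrow> ivec" where
  "monomial_degree n B0 c =
     (\<Sum>i\<in>{1..n}. vscale (Poly_Mapping.lookup c i) (unit_vec i))
   + (\<Sum>i\<in>{1..n}. vscale (Poly_Mapping.lookup c (n + i))
         (- (\<Sum>l\<in>{1..n}. Poly_Mapping.single l (B0 l i))))"

text \<open>
  \<open>z\<close> is a nonzero element of \<open>\<int>[x\<^sub>1\<^sup>\<plusminus>\<^sup>1, \<dots>, x\<^sub>n\<^sup>\<plusminus>\<^sup>1, y\<^sub>1, \<dots>, y\<^sub>n]\<close>, homogeneous of degree \<open>g\<close>.
\<close>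

definition homogeneous_of_degree :: "nat \<Rightarrow> imat \<Rightarrow> ivec \<Rightarrow> laurent fract \<Rightarrow> bool" where
  "homogeneous_of_degree n B0 g z \<longleftrightarrow>
     (\<exists>P. P \<noteq> 0 \<and> z = laurent_fract P \<and>
        (\<forall>c\<in>Poly_Mapping.keys P. c \<in> zvecs (2*n)
            \<and> (\<forall>i\<in>{1..n}. Poly_Mapping.lookup c (n + i) \<ge> 0)
            \<and> monomial_degree n B0 c = g))"

definition is_g_vectors :: "nat \<Rightarrow> imat \<Rightarrow> nat list \<Rightarrow> (nat list \<Rightarrow> nat \<Rightarrow> ivec) \<Rightarrow> bool" where
  "is_g_vectors n B0 t0 g \<longleftrightarrow>
     (\<exists>x b. classical_principal_pattern n B0 t0 x b
        \<and> (\<forall>t\<in>tree_vertices n. \<forall>j\<in>{1..n}. homogeneous_of_degree n B0 (g t j) (x t j)))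
   \<and> (\<forall>t\<in>tree_vertices n. \<forall>j\<in>{n+1..2*n}. g t j = unit_vec j)"

section \<open>Quantum tori and their skew-fields of fractions\<close>

text \<open>
  The ring \<open>\<int>[q\<^sup>\<plusminus>\<^sup>1\<^sup>/\<^sup>2]\<close> is represented by coefficient families: an element \<open>a\<close> is the sum of the
  \<open>lookup a k \<cdot> q\<^bsup>k/2\<^esup>\<close>. In a division ring the element \<open>v\<close> always plays the role of \<open>q\<^sup>1\<^sup>/\<^sup>2\<close>.
\<close>

type_synonym qcoeff = "int \<Rightarrow>\<^sub>0 int"

definition qcoeff_eval :: "'f::division_ring \<Rightarrow> qcoeff \<Rightarrow> 'f" where
  "qcoeff_eval v a = (\<Sum>k\<in>Poly_Mapping.keys a. of_int (Poly_Mapping.lookup a k) * v powi k)"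

definition lincomb :: "'f::division_ring \<Rightarrow> ('e \<Rightarrow> 'f) \<Rightarrow> ('e \<Rightarrow>\<^sub>0 qcoeff) \<Rightarrow> 'f" where
  "lincomb v X p = (\<Sum>e\<in>Poly_Mapping.keys p. qcoeff_eval v (Poly_Mapping.lookup p e) * X e)"

text \<open>\<open>q\<^sup>r\<close> for half-integral \<open>r\<close>.\<close>

definition q_power :: "'f::division_ring \<Rightarrow> rat \<Rightarrow> 'f" where
  "q_power v r = v powi \<lfloor>2 * r\<rfloor>"

text \<open>
  The family \<open>(X e)\<^bsub>e \<in> E\<^esub>\<close> is a basis of a free \<open>\<int>[q\<^sup>\<plusminus>\<^sup>1\<^sup>/\<^sup>2]\<close>-module (with \<open>q\<^sup>1\<^sup>/\<^sup>2 = v\<close> central), and every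
  element of the division ring is a fraction of elements of this module. In both uses below the
  module is a subring, so the division ring is (a copy of) its skew-field of fractions.
\<close>

definition fractions_of_span :: "'f::division_ring \<Rightarrow> 'e set \<Rightarrow> ('e \<Rightarrow> 'f) \<Rightarrow> bool" where
  "fractions_of_span v E X \<longleftrightarrow>
     v \<noteq> 0 \<and> (\<forall>z. v * z = z * v)
   \<and> inj_on (lincomb v X) {p. Poly_Mapping.keys p \<subseteq> E}
   \<and> (\<forall>z. \<exists>p r. Poly_Mapping.keys p \<subseteq> E \<and> Poly_Mapping.keys r \<subseteq> E
          \<and> lincomb v X r \<noteq> 0 \<and> z = lincomb v X p * inverse (lincomb v X r))"

definition skew_bilinear_form :: "('l::ab_group_add \<Rightarrow> 'l \<Rightarrow> int) \<Rightarrow> bool" where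
  "skew_bilinear_form \<Lambda>L \<longleftrightarrow>
     (\<forall>e f h. \<Lambda>L (e + f) h = \<Lambda>L e h + \<Lambda>L f h) \<and> (\<forall>e f. \<Lambda>L e f = - \<Lambda>L f e)"

text \<open>
  The type \<open>'l\<close> is the lattice \<open>L\<close> and the type \<open>'f\<close> is the ambient skew-field. That \<open>L\<close> is free of
  rank \<open>m\<close> is part of the existence of a toric frame below.
\<close>

definition ambient_skew_field ::
    "'f::division_ring \<Rightarrow> ('l::ab_group_add \<Rightarrow> 'l \<Rightarrow> int) \<Rightarrow> ('l \<Rightarrow> 'f) \<Rightarrow> bool" where
  "ambient_skew_field v \<Lambda>L X \<longleftrightarrow>
     skew_bilinear_form \<Lambda>L
   \<and> fractions_of_span v UNIV X
   \<and> (\<forall>e f. X e * X f = v powi \<Lambda>L e f * X (e + f))"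

section \<open>Quantum cluster patterns\<close>

definition skew_field_automorphism :: "'f::division_ring \<Rightarrow> ('f \<Rightarrow> 'f) \<Rightarrow> bool" where
  "skew_field_automorphism v \<phi> \<longleftrightarrow>
     bij \<phi> \<and> (\<forall>x y. \<phi> (x + y) = \<phi> x + \<phi> y) \<and> (\<forall>x y. \<phi> (x * y) = \<phi> x * \<phi> y) \<and> \<phi> v = v"

definition lattice_isomorphism :: "nat \<Rightarrow> (ivec \<Rightarrow> 'l::ab_group_add) \<Rightarrow> bool" where
  "lattice_isomorphism m \<eta> \<longleftrightarrow>
     bij_betw \<eta> (zvecs m) UNIV \<and> (\<forall>c\<in>zvecs m. \<forall>d\<in>zvecs m. \<eta> (c + d) = \<eta> c + \<eta> d)"

text \<open>\<open>M\<close> is a toric frame on \<open>\<int>\<^sup>m\<close> and \<open>\<Lambda>M\<close> is the form transferred from the lattice.\<close>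

definition toric_frame ::
    "'f::division_ring \<Rightarrow> ('l::ab_group_add \<Rightarrow> 'l \<Rightarrow> int) \<Rightarrow> ('l \<Rightarrow> 'f) \<Rightarrow> nat \<Rightarrow>
     (ivec \<Rightarrow> 'f) \<Rightarrow> (ivec \<Rightarrow> ivec \<Rightarrow> int) \<Rightarrow> bool" where
  "toric_frame v \<Lambda>L X m M \<Lambda>M \<longleftrightarrow>
     (\<exists>\<phi> \<eta>. skew_field_automorphism v \<phi> \<and> lattice_isomorphism m \<eta>
        \<and> (\<forall>c\<in>zvecs m. M c = \<phi> (X (\<eta> c)))
        \<and> (\<forall>c\<in>zvecs m. \<forall>d\<in>zvecs m. \<Lambda>M c d = \<Lambda>L (\<eta> c) (\<eta> d)))"

text \<open>The condition \<open>B\<^sup>T \<Lambda> = (D | 0)\<close> for an \<open>m \<times> n\<close> matrix, with \<open>D = diag(d\<^sub>1, \<dots>, d\<^sub>n)\<close>.\<close>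

definition compatible_pair ::
    "nat \<Rightarrow> nat \<Rightarrow> (nat \<Rightarrow> int) \<Rightarrow> imat \<Rightarrow> (ivec \<Rightarrow> ivec \<Rightarrow> int) \<Rightarrow> bool" where
  "compatible_pair m n d b \<Lambda>M \<longleftrightarrow>
     (\<forall>j\<in>{1..n}. \<forall>i\<in>{1..m}.
        (\<Sum>l\<in>{1..m}. b l j * \<Lambda>M (unit_vec l) (unit_vec i)) = (if i = j then d j else 0))"

definition quantum_seed ::
    "'f::division_ring \<Rightarrow> ('l::ab_group_add \<Rightarrow> 'l \<Rightarrow> int) \<Rightarrow> ('l \<Rightarrow> 'f) \<Rightarrow> nat \<Rightarrow> nat \<Rightarrow> (nat \<Rightarrow> int) \<Rightarrow>
     (ivec \<Rightarrow> 'f) \<Rightarrow> (ivec \<Rightarrow> ivec \<Rightarrow> int) \<Rightarrow> imat \<Rightarrow> bool" where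
  "quantum_seed v \<Lambda>L X m n d M \<Lambda>M b \<longleftrightarrow>
     toric_frame v \<Lambda>L X m M \<Lambda>M \<and> compatible_pair m n d b \<Lambda>M"

text \<open>
  The toric frame \<open>M'\<close> of the mutated seed is determined by its values on the unit vectors, so it
  suffices to prescribe those.
\<close>

definition quantum_mutation ::
    "nat \<Rightarrow> nat \<Rightarrow> nat \<Rightarrow> (ivec \<Rightarrow> 'f::division_ring) \<Rightarrow> imat \<Rightarrow> (ivec \<Rightarrow> 'f) \<Rightarrow> imat \<Rightarrow> bool" where
  "quantum_mutation m n k M b M' b' \<longleftrightarrow>
     matrix_mutation m n k b b'
   \<and> (\<forall>i\<in>{1..m}. i \<noteq> k \<longrightarrow> M' (unit_vec i) = M (unit_vec i))
   \<and> M' (unit_vec k) =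
        M (- unit_vec k + (\<Sum>i\<in>{1..m}. vscale (pos_part (b i k)) (unit_vec i)))
      + M (- unit_vec k + (\<Sum>i\<in>{1..m}. vscale (pos_part (- b i k)) (unit_vec i)))"

definition quantum_cluster_pattern ::
    "'f::division_ring \<Rightarrow> ('l::ab_group_add \<Rightarrow> 'l \<Rightarrow> int) \<Rightarrow> ('l \<Rightarrow> 'f) \<Rightarrow> nat \<Rightarrow> nat \<Rightarrow> (nat \<Rightarrow> int) \<Rightarrow>
     (nat list \<Rightarrow> ivec \<Rightarrow> 'f) \<Rightarrow> (nat list \<Rightarrow> ivec \<Rightarrow> ivec \<Rightarrow> int) \<Rightarrow> (nat list \<Rightarrow> imat) \<Rightarrow> bool" where
  "quantum_cluster_pattern v \<Lambda>L X m n d M \<Lambda>M b \<longleftrightarrow>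
     ambient_skew_field v \<Lambda>L X
   \<and> (\<forall>t\<in>tree_vertices n. quantum_seed v \<Lambda>L X m n d (M t) (\<Lambda>M t) (b t))
   \<and> (\<forall>k t t'. tree_edge n k t t' \<longrightarrow> quantum_mutation m n k (M t) (b t) (M t') (b t'))"

text \<open>
  The pattern of \<open>\<A>\<^sub>\<bullet>(B0, D, \<Lambda>, t0)\<close>: principal coefficients at \<open>t0\<close>, where \<open>\<Lambda>\<close> is the upper left
  \<open>n \<times> n\<close> block of the initial form (its remaining entries are forced by compatibility).
\<close>

definition principal_quantum_pattern ::
    "'f::division_ring \<Rightarrow> ('l::ab_group_add \<Rightarrow> 'l \<Rightarrow> int) \<Rightarrow> ('l \<Rightarrow> 'f) \<Rightarrow> nat \<Rightarrow> (nat \<Rightarrow> int) \<Rightarrow>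
     imat \<Rightarrow> imat \<Rightarrow> nat list \<Rightarrow>
     (nat list \<Rightarrow> ivec \<Rightarrow> 'f) \<Rightarrow> (nat list \<Rightarrow> ivec \<Rightarrow> ivec \<Rightarrow> int) \<Rightarrow> (nat list \<Rightarrow> imat) \<Rightarrow> bool" where
  "principal_quantum_pattern v \<Lambda>L X n d B0 \<Lambda> t0 M \<Lambda>M b \<longleftrightarrow>
     quantum_cluster_pattern v \<Lambda>L X (2*n) n d M \<Lambda>M b
   \<and> is_principal_matrix n B0 (b t0)
   \<and> (\<forall>i\<in>{1..n}. \<forall>j\<in>{1..n}. \<Lambda>M t0 (unit_vec i) (unit_vec j) = \<Lambda> i j)"

definition Y_hat :: "nat \<Rightarrow> (ivec \<Rightarrow> 'f::division_ring) \<Rightarrow> imat \<Rightarrow> nat \<Rightarrow> 'f" where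
  "Y_hat n M0 b0 j = M0 (\<Sum>i\<in>{1..2*n}. vscale (b0 i j) (unit_vec i))"

definition rho_entry ::
    "(nat list \<Rightarrow> ivec \<Rightarrow> ivec \<Rightarrow> int) \<Rightarrow> nat list \<Rightarrow> (nat list \<Rightarrow> nat \<Rightarrow> ivec) \<Rightarrow> nat list \<Rightarrow> imat" where
  "rho_entry \<Lambda>M t0 g t i j = \<Lambda>M t (unit_vec i) (unit_vec j) - \<Lambda>M t0 (g t i) (g t j)"

section \<open>The quantum torus \<open>\<R>\<close> and quantum F-polynomials\<close>

text \<open>
  The normalised monomial \<open>Z\<^sup>c\<close> formed from elements \<open>Z\<^sub>1, \<dots>, Z\<^sub>n\<close> of a division ring. The exponent of
  \<open>v = q\<^sup>1\<^sup>/\<^sup>2\<close> is twice that of \<open>q\<close>.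
\<close>

definition torus_monomial ::
    "nat \<Rightarrow> (nat \<Rightarrow> int) \<Rightarrow> imat \<Rightarrow> 'f::division_ring \<Rightarrow> (nat \<Rightarrow> 'f) \<Rightarrow> ivec \<Rightarrow> 'f" where
  "torus_monomial n d B0 v Z c =
     v powi (\<Sum>j\<in>{1..n}. \<Sum>i\<in>{1..<j}.
               d j * B0 j i * Poly_Mapping.lookup c i * Poly_Mapping.lookup c j)
   * prod_list (map (\<lambda>i. Z i powi Poly_Mapping.lookup c i) [1..<Suc n])"

text \<open>
  The division ring containing \<open>w = q\<^sup>1\<^sup>/\<^sup>2\<close> and \<open>Z\<^sub>1, \<dots>, Z\<^sub>n\<close> is the skew-field of fractions of the
  quantum torus \<open>\<R>\<close>.
\<close>

definition torus_skew_field ::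
    "nat \<Rightarrow> (nat \<Rightarrow> int) \<Rightarrow> imat \<Rightarrow> 'k::division_ring \<Rightarrow> (nat \<Rightarrow> 'k) \<Rightarrow> bool" where
  "torus_skew_field n d B0 w Z \<longleftrightarrow>
     fractions_of_span w (zvecs n) (torus_monomial n d B0 w Z)
   \<and> (\<forall>i\<in>{1..n}. Z i \<noteq> 0)
   \<and> (\<forall>i\<in>{1..n}. \<forall>j\<in>{1..n}. Z i * Z j = w powi (2 * (d i * B0 i j)) * (Z j * Z i))"

text \<open>Coefficients of an element of \<open>\<R>\<close> with respect to the basis of monomials \<open>Z\<^sup>c\<close>.\<close>

definition torus_coeffs ::
    "nat \<Rightarrow> (nat \<Rightarrow> int) \<Rightarrow> imat \<Rightarrow> 'k::division_ring \<Rightarrow> (nat \<Rightarrow> 'k) \<Rightarrow> 'k \<Rightarrow> (ivec \<Rightarrow>\<^sub>0 qcoeff)" where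
  "torus_coeffs n d B0 w Z f =
     (THE p. Poly_Mapping.keys p \<subseteq> zvecs n \<and> lincomb w (torus_monomial n d B0 w Z) p = f)"

definition torus_polynomials ::
    "nat \<Rightarrow> (nat \<Rightarrow> int) \<Rightarrow> imat \<Rightarrow> 'k::division_ring \<Rightarrow> (nat \<Rightarrow> 'k) \<Rightarrow> 'k set" where
  "torus_polynomials n d B0 w Z =
     lincomb w (torus_monomial n d B0 w Z) `
       {p. Poly_Mapping.keys p \<subseteq> {c \<in> zvecs n. \<forall>i. Poly_Mapping.lookup c i \<ge> 0}}"

text \<open>
  The substitution \<open>Z\<^sub>i \<mapsto> Y\<^sub>i\<close>, from \<open>\<R>\<close> to the ambient skew-field in which \<open>v = q\<^sup>1\<^sup>/\<^sup>2\<close>.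
\<close>

definition torus_subst ::
    "nat \<Rightarrow> (nat \<Rightarrow> int) \<Rightarrow> imat \<Rightarrow> 'k::division_ring \<Rightarrow> (nat \<Rightarrow> 'k) \<Rightarrow>
     'f::division_ring \<Rightarrow> (nat \<Rightarrow> 'f) \<Rightarrow> 'k \<Rightarrow> 'f" where
  "torus_subst n d B0 w Z v Y f =
     lincomb v (torus_monomial n d B0 v Y) (torus_coeffs n d B0 w Z f)"

text \<open>The operator \<open>L[a]\<close> on \<open>\<R>\<close>.\<close>

definition torus_L ::
    "nat \<Rightarrow> (nat \<Rightarrow> int) \<Rightarrow> imat \<Rightarrow> 'k::division_ring \<Rightarrow> (nat \<Rightarrow> 'k) \<Rightarrow> ivec \<Rightarrow> 'k \<Rightarrow> 'k" where
  "torus_L n d B0 w Z a f =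
     lincomb w
       (\<lambda>c. q_power w (- of_int (\<Sum>i\<in>{1..n}. Poly_Mapping.lookup a i * Poly_Mapping.lookup c i * d i))
              * torus_monomial n d B0 w Z c)
       (torus_coeffs n d B0 w Z f)"

definition is_quantum_F_polynomials ::
    "nat \<Rightarrow> (nat \<Rightarrow> int) \<Rightarrow> imat \<Rightarrow> nat list \<Rightarrow> 'k::division_ring \<Rightarrow> (nat \<Rightarrow> 'k) \<Rightarrow>
     'f::division_ring \<Rightarrow> (nat list \<Rightarrow> ivec \<Rightarrow> 'f) \<Rightarrow> (nat list \<Rightarrow> imat) \<Rightarrow>
     (nat list \<Rightarrow> nat \<Rightarrow> ivec) \<Rightarrow> (nat list \<Rightarrow> nat \<Rightarrow> 'k) \<Rightarrow> bool" where
  "is_quantum_F_polynomials n d B0 t0 w Z v M b g F \<longleftrightarrow>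
     (\<forall>t\<in>tree_vertices n. \<forall>j\<in>{1..n}.
        F t j \<in> torus_polynomials n d B0 w Z
      \<and> M t (unit_vec j) =
          torus_subst n d B0 w Z v (Y_hat n (M t0) (b t0)) (F t j) * M t0 (g t j))"

section \<open>Ingredients of the recurrence\<close>

text \<open>
  Here \<open>L\<close> is the family of operators \<open>L[a]\<close>, while \<open>b\<close>, \<open>g\<close>, \<open>F\<close> and \<open>\<rho>\<close> are the exchange matrix, the
  g-vectors, the F-polynomials and the matrix \<open>\<rho>\<^sup>t\<close> at a fixed vertex. The sign \<open>\<epsilon>\<close> is \<open>1\<close> or \<open>-1\<close>.
\<close>

definition G_factor ::
    "(ivec \<Rightarrow> 'k::division_ring \<Rightarrow> 'k) \<Rightarrow> imat \<Rightarrow> (nat \<Rightarrow> ivec) \<Rightarrow> (nat \<Rightarrow> 'k) \<Rightarrow> nat \<Rightarrow> int \<Rightarrow> nat \<Rightarrow> 'k" where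
  "G_factor L b g F k \<epsilon> j =
     prod_list (map (\<lambda>i. L (vscale (int i - 1) (g j)) (F j)) [1..<Suc (nat (pos_part (\<epsilon> * b j k)))])"

definition F_hat ::
    "(ivec \<Rightarrow> 'k::division_ring \<Rightarrow> 'k) \<Rightarrow> imat \<Rightarrow> (nat \<Rightarrow> ivec) \<Rightarrow> (nat \<Rightarrow> 'k) \<Rightarrow> nat \<Rightarrow> int \<Rightarrow> nat \<Rightarrow> 'k" where
  "F_hat L b g F k \<epsilon> j =
     (if j = k then 1
      else L (- g k + (\<Sum>i\<in>{1..<j}. vscale (pos_part (\<epsilon> * b i k)) (g i))) (G_factor L b g F k \<epsilon> j))"

definition F_hat_inv ::
    "(ivec \<Rightarrow> 'k::division_ring \<Rightarrow> 'k) \<Rightarrow> (nat \<Rightarrow> ivec) \<Rightarrow> (nat \<Rightarrow> 'k) \<Rightarrow> nat \<Rightarrow> 'k" where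
  "F_hat_inv L g F k = inverse (L (- g k) (F k))"

definition rho_exponent :: "nat \<Rightarrow> imat \<Rightarrow> imat \<Rightarrow> nat \<Rightarrow> int \<Rightarrow> rat" where
  "rho_exponent n b \<rho> k \<epsilon> =
     1/2 * of_int
       (- (\<Sum>i\<in>{1..2*n}. pos_part (\<epsilon> * b i k) * \<rho> i k)
        + (\<Sum>j\<in>{1..n}. \<Sum>i\<in>{1..<j}. pos_part (\<epsilon> * b i k) * pos_part (\<epsilon> * b j k) * \<rho> j i)
        + (\<Sum>i\<in>{1..n}. \<Sum>j\<in>{1..n}.
             pos_part (\<epsilon> * b i k) * pos_part (\<epsilon> * b (n + j) k) * \<rho> (n + j) i))"

text \<open>Here \<open>g'\<close> is the g-vector of the new cluster variable.\<close>

definition lambda_exponent :: "nat \<Rightarrow> (nat \<Rightarrow> int) \<Rightarrow> imat \<Rightarrow> ivec \<Rightarrow> nat \<Rightarrow> int \<Rightarrow> rat" where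
  "lambda_exponent n d b g' k \<epsilon> =
     1/2 * of_int (\<Sum>i\<in>{1..n}. pos_part (\<epsilon> * b (n + i) k) * Poly_Mapping.lookup g' i * d i)"

end

theory Submission
  imports Defs
begin

text \<open>
  Expand the two terms of the exchange relation for \<open>M\<^sub>t\<close> into ordered products of cluster variables
  at \<open>t\<close>, write each of these as \<open>F(Y) M\<^sub>0(g)\<close>, and move every frame element \<open>M\<^sub>0(a)\<close> to the right
  by \<open>M\<^sub>0(a) f(Y) = (L[a] f)(Y) M\<^sub>0(a)\<close>. The reordering scalars coming from \<open>\<Lambda>\<^sub>t\<close> and from \<open>\<Lambda>\<^sub>0\<close>
  cancel up to the entries of \<open>\<rho>\<^sup>t\<close>. Homogeneity of both terms of the classical exchange relation shows
  that either product has degree \<open>g'\<close> up to a monomial in \<open>Y\<close>, and splitting this monomial off costs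
  \<open>q\<^sup>-\<^sup>\<lambda>\<close>. After multiplication by \<open>L[-g\<^sub>k] F\<^sub>k\<close> the recurrence is an identity in the quantum torus
  itself, where the substitution \<open>Z \<mapsto> Y\<close> is an injective ring homomorphism; so no homomorphism
  between skew-fields of fractions is needed.
\<close>

section \<open>Integer vectors\<close>

text \<open>Compatibility of the initial seed is what produces the operators L[a]: the form of the
  frame at \<open>t0\<close> pairs column j of the initial matrix with c to d_j c_j. So
  \<open>M0 a\<close> and the Y-monomial of exponent c commute up to q to the power minus the sum of
  a_i c_i d_i, which is the eigenvalue of L[a] on the Z-monomial of exponent c. The identity block
  makes the columns independent, and on them the initial form becomes that of R. Hence R and its
  image have equal structure constants although they live in unrelated types; equality of
  coefficients is the only link between them. The matrix \<rho> is the defect between two costs: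
  splitting a monomial of \<open>M t\<close> costs the form at t on unit vectors, while merging the
  resulting \<open>M0\<close> factors costs the form at \<open>t0\<close> on g-vectors. The factor
  L[-g_k] F_k is cleared because its inverse need not lie in R, where coefficients are defined. The
  g-vectors come with a classical pattern of their own, whose exchange matrices must be identified
  with the quantum ones along the tree.\<close>

lemma lookup_vscale [simp]: "Poly_Mapping.lookup (vscale s c) i = s * Poly_Mapping.lookup c i"
  by (simp add: vscale_def map.rep_eq when_def)

lemma zvecs_iff: "c \<in> zvecs m \<longleftrightarrow> (\<forall>i. i \<notin> {1..m} \<longrightarrow> Poly_Mapping.lookup c i = 0)"
  by (auto simp: zvecs_def in_keys_iff)

lemma zvecs_0 [simp, intro]: "0 \<in> zvecs m"
  by (simp add: zvecs_iff)

lemma zvecs_add [intro]: "c \<in> zvecs m \<Longrightarrow> d \<in> zvecs m \<Longrightarrow> c + d \<in> zvecs m"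
  by (simp add: zvecs_iff lookup_add)

lemma zvecs_uminus [intro]: "c \<in> zvecs m \<Longrightarrow> - c \<in> zvecs m"
  by (simp add: zvecs_iff)

lemma zvecs_vscale [intro]: "c \<in> zvecs m \<Longrightarrow> vscale s c \<in> zvecs m"
  by (simp add: zvecs_iff)

lemma zvecs_sum [intro]: "(\<And>i. i \<in> I \<Longrightarrow> c i \<in> zvecs m) \<Longrightarrow> sum c I \<in> zvecs m"
  by (auto simp: zvecs_iff lookup_sum)

lemma zvecs_unit [intro]: "i \<in> {1..m} \<Longrightarrow> unit_vec i \<in> zvecs m"
  by (auto simp: zvecs_iff lookup_single when_def)

lemma zvecs_mono: "c \<in> zvecs m \<Longrightarrow> m \<le> m' \<Longrightarrow> c \<in> zvecs m'"
  by (auto simp: zvecs_def)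

lemma vscale_algebra [simp]:
  "vscale 0 c = 0" "vscale 1 c = c" "vscale s 0 = 0" "vscale (- s) c = - vscale s c"
  by (auto intro!: poly_mapping_eqI)

lemma vscale_add_left: "vscale (a + b) c = vscale a c + vscale b c"
  by (auto intro!: poly_mapping_eqI simp: lookup_add algebra_simps)

lemma vscale_add_right: "vscale a (c + d) = vscale a c + vscale a d"
  by (auto intro!: poly_mapping_eqI simp: lookup_add algebra_simps)

lemma lookup_sum_unit:
  assumes "finite I"
  shows "Poly_Mapping.lookup (\<Sum>i\<in>I. vscale (a i) (unit_vec i)) j = (if j \<in> I then a j else 0)"
proof -
  have "Poly_Mapping.lookup (\<Sum>i\<in>I. vscale (a i) (unit_vec i)) j = (\<Sum>i\<in>I. if i = j then a j else 0)"
    unfolding lookup_sum by (rule sum.cong) (auto simp: lookup_single when_def)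
  then show ?thesis using assms by simp
qed

lemma zvecs_expand:
  assumes "c \<in> zvecs m"
  shows "c = (\<Sum>i\<in>{1..m}. vscale (Poly_Mapping.lookup c i) (unit_vec i))"
  using assms by (intro poly_mapping_eqI, subst lookup_sum_unit) (auto simp: zvecs_iff)

section \<open>Linear combinations\<close>

lemma qcoeff_eval_superset:
  assumes "finite K" "Poly_Mapping.keys a \<subseteq> K"
  shows "qcoeff_eval v a = (\<Sum>k\<in>K. of_int (Poly_Mapping.lookup a k) * v powi k)"
  unfolding qcoeff_eval_def by (rule sum.mono_neutral_left) (use assms in \<open>auto simp: in_keys_iff\<close>)

lemma qcoeff_eval_0 [simp]: "qcoeff_eval v 0 = 0"
  by (simp add: qcoeff_eval_def)

lemma qcoeff_eval_single: "qcoeff_eval v (Poly_Mapping.single k c) = of_int c * v powi k"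
  by (simp add: qcoeff_eval_def)

lemma qcoeff_eval_add: "qcoeff_eval v (a + b) = qcoeff_eval v a + qcoeff_eval v b"
proof -
  let ?K = "Poly_Mapping.keys a \<union> Poly_Mapping.keys b"
  have "qcoeff_eval v x = (\<Sum>k\<in>?K. of_int (Poly_Mapping.lookup x k) * v powi k)" if "x \<in> {a, b, a + b}" for x
    by (rule qcoeff_eval_superset) (use that keys_add[of a b] in auto)
  then show ?thesis
    by (simp add: lookup_add distrib_right sum.distrib)
qed

lemma central_power_int:
  fixes v :: "'f::division_ring"
  assumes "\<And>z. v * z = z * v"
  shows "v powi k * z = z * v powi k"
proof -
  have pow: "v ^ n * z = z * v ^ n" for n z
    by (induction n) (simp_all, metis assms mult.assoc)
  have "inverse (v ^ n) * z = z * inverse (v ^ n)" for n z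
  \<comment> \<open>The lemma allows \<open>v = 0\<close>; in that case the convention
    \<open>inverse 0 = 0\<close> settles the claim.\<close>
  proof (cases "v ^ n = 0")
    case False
    have "inverse (v ^ n) * z = inverse (v ^ n) * (z * v ^ n) * inverse (v ^ n)"
      using False by (simp add: mult.assoc)
    also have "\<dots> = inverse (v ^ n) * v ^ n * (z * inverse (v ^ n))"
      unfolding pow[of n z, symmetric] by (simp only: mult.assoc)
    finally show ?thesis using False by simp
  next
    case True
    then show ?thesis by (simp only: inverse_zero mult_zero_left mult_zero_right)
  qed
  then show ?thesis
    using pow by (simp add: power_int_def power_inverse)
qed

lemma central_qcoeff_eval:
  fixes v :: "'f::division_ring"
  assumes "\<And>z. v * z = z * v"
  shows "qcoeff_eval v a * z = z * qcoeff_eval v a"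
  unfolding qcoeff_eval_def sum_distrib_left sum_distrib_right
  by (intro sum.cong refl) (metis assms central_power_int mult.assoc mult_of_int_commute)

lemma lincomb_superset:
  assumes "finite S" "Poly_Mapping.keys p \<subseteq> S"
  shows "lincomb v X p = (\<Sum>e\<in>S. qcoeff_eval v (Poly_Mapping.lookup p e) * X e)"
  unfolding lincomb_def by (rule sum.mono_neutral_left) (use assms in \<open>auto simp: in_keys_iff\<close>)

lemma lincomb_0 [simp]: "lincomb v X 0 = 0"
  by (simp add: lincomb_def)

lemma lincomb_single: "lincomb v X (Poly_Mapping.single e a) = qcoeff_eval v a * X e"
  by (simp add: lincomb_def)

lemma lincomb_add: "lincomb v X (p + r) = lincomb v X p + lincomb v X r"
proof -
  let ?S = "Poly_Mapping.keys p \<union> Poly_Mapping.keys r"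
  have "lincomb v X x = (\<Sum>e\<in>?S. qcoeff_eval v (Poly_Mapping.lookup x e) * X e)" if "x \<in> {p, r, p + r}" for x
    by (rule lincomb_superset) (use that keys_add[of p r] in auto)
  then show ?thesis
    by (simp add: lookup_add qcoeff_eval_add distrib_right sum.distrib)
qed

lemma lincomb_sum: "lincomb v X (sum p I) = (\<Sum>i\<in>I. lincomb v X (p i))"
  by (induction I rule: infinite_finite_induct) (auto simp: lincomb_add)

lemma lincomb_diff: "lincomb v X (p - r) = lincomb v X p - lincomb v X r"
  using lincomb_add[of v X "p - r" r] by (simp add: algebra_simps)

lemma lincomb_cong:
  "(\<And>e. e \<in> Poly_Mapping.keys p \<Longrightarrow> X e = X' e) \<Longrightarrow> lincomb v X p = lincomb v X' p"
  unfolding lincomb_def by (rule sum.cong) auto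

lemma inj_on_lincomb_iff:
  "inj_on (lincomb v X) {p. Poly_Mapping.keys p \<subseteq> E} \<longleftrightarrow>
     (\<forall>p. Poly_Mapping.keys p \<subseteq> E \<longrightarrow> lincomb v X p = 0 \<longrightarrow> p = 0)" (is "?L \<longleftrightarrow> ?R")
proof
  assume ?L
  then show ?R
    using inj_onD[of "lincomb v X" _ _ 0] by simp
next
  assume R: ?R
  show ?L
  proof (rule inj_onI)
    fix p r assume a: "p \<in> {p. Poly_Mapping.keys p \<subseteq> E}" "r \<in> {p. Poly_Mapping.keys p \<subseteq> E}"
      "lincomb v X p = lincomb v X r"
    have "Poly_Mapping.keys (p - r) \<subseteq> E"
      using a by (auto dest!: subsetD[OF keys_diff])
    moreover have "lincomb v X (p - r) = 0" using a by (simp add: lincomb_diff)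
    ultimately have "p - r = 0" using R by blast
    then show "p = r" by simp
  qed
qed

text \<open>Coefficients are pushed forward along \<eta>. As \<eta> is injective, no two of them are
  merged, so a relation among the reindexed family is a relation among the \<open>X\<close> with the
  same coefficients.\<close>

lemma inj_on_lincomb_reindex:
  assumes inj: "inj_on (lincomb v X) {p. Poly_Mapping.keys p \<subseteq> F}"
    and \<eta>: "inj_on \<eta> E" "\<eta> ` E \<subseteq> F"
  shows "inj_on (lincomb v (\<lambda>e. X (\<eta> e))) {p. Poly_Mapping.keys p \<subseteq> E}"
  unfolding inj_on_lincomb_iff
proof (intro allI impI)
  fix p assume p: "Poly_Mapping.keys p \<subseteq> E" and 0: "lincomb v (\<lambda>e. X (\<eta> e)) p = 0"
  define r where "r = (\<Sum>e\<in>Poly_Mapping.keys p. Poly_Mapping.single (\<eta> e) (Poly_Mapping.lookup p e))"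
  have "lincomb v X r = 0"
    using 0 unfolding r_def lincomb_sum lincomb_single lincomb_def[of v "\<lambda>e. X (\<eta> e)"] .
  moreover have "Poly_Mapping.keys r \<subseteq> F"
    unfolding r_def by (rule order_trans[OF keys_sum]) (use p \<eta> in \<open>auto split: if_splits\<close>)
  ultimately have r: "r = 0"
    using inj unfolding inj_on_lincomb_iff by blast
  have "Poly_Mapping.lookup p e = Poly_Mapping.lookup r (\<eta> e)" if "e \<in> Poly_Mapping.keys p" for e
  proof -
    have "Poly_Mapping.lookup r (\<eta> e) =
        (\<Sum>x\<in>Poly_Mapping.keys p. if x = e then Poly_Mapping.lookup p e else 0)"
      unfolding r_def lookup_sum
      by (rule sum.cong) (use that p \<eta>(1) in \<open>auto simp: lookup_single when_def inj_on_def\<close>)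
    then show ?thesis using that by simp
  qed
  then show "p = 0"
    using r by (intro poly_mapping_eqI) (metis in_keys_iff lookup_zero)
qed

text \<open>A bijection compatible with sums and products fixes 0, 1 and the integers; if it also
  fixes \<open>v\<close>, it fixes every power of \<open>v\<close> and is linear over the
  coefficient ring.\<close>

lemma skew_field_automorphism_lincomb:
  assumes "skew_field_automorphism v \<phi>"
  shows "\<phi> (lincomb v X p) = lincomb v (\<lambda>e. \<phi> (X e)) p"
proof -
  have add: "\<phi> (x + y) = \<phi> x + \<phi> y" and mult: "\<phi> (x * y) = \<phi> x * \<phi> y" and \<phi>v: "\<phi> v = v"
    and inj: "inj \<phi>" for x y
    using assms by (auto simp: skew_field_automorphism_def bij_def)
  have zero: "\<phi> 0 = 0"
    using add[of 0 0] by simp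
  have one: "\<phi> 1 = 1"
    using mult[of 1 1] zero inj by (metis injD mult_cancel_right1 zero_neq_one)
  have minus: "\<phi> (- x) = - \<phi> x" for x
    using add[of x "- x"] zero by (simp add: add_eq_0_iff)
  have nat: "\<phi> (of_nat k) = of_nat k" for k
    by (induction k) (simp_all add: zero one add)
  have int: "\<phi> (of_int k) = of_int k" for k
    by (cases k rule: int_cases2) (simp_all add: nat minus)
  have inverse: "\<phi> (inverse v) = inverse v"
    by (metis \<phi>v inverse_unique inverse_zero mult one right_inverse zero)
  have pow: "\<phi> (x ^ k) = \<phi> x ^ k" for x k
    by (induction k) (simp_all add: one mult)
  have powi: "\<phi> (v powi k) = v powi k" for k
    by (simp add: power_int_def pow \<phi>v inverse)
  have sum: "\<phi> (sum f I) = (\<Sum>i\<in>I. \<phi> (f i))" for f :: "'c \<Rightarrow> _" and I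
    by (induction I rule: infinite_finite_induct) (simp_all add: zero add)
  have sum': "\<phi> (sum f I) = (\<Sum>i\<in>I. \<phi> (f i))" for f :: "int \<Rightarrow> _" and I
    by (induction I rule: infinite_finite_induct) (simp_all add: zero add)
  show ?thesis
    by (simp add: lincomb_def qcoeff_eval_def sum sum' mult int powi)
qed

section \<open>Quantum frames\<close>

locale central_unit =
  fixes v :: "'f::division_ring"
  assumes v_nonzero: "v \<noteq> 0"
    and v_central: "v * z = z * v"
begin

lemma vpow_central: "v powi k * z = z * v powi k"
  using central_power_int v_central .

lemma vpow_left_commute: "z * (v powi k * y) = v powi k * (z * y)"
  by (metis mult.assoc vpow_central)

lemma vpow_add: "v powi (i + j) = v powi i * v powi j"
  using power_int_add v_nonzero by blast

text \<open>The exponent counts powers of \<open>v\<close>, the square root of q; a relation with a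
  power r of q therefore appears below with exponent \<open>2 * r\<close>.\<close>

definition q_commute :: "int \<Rightarrow> 'f \<Rightarrow> 'f \<Rightarrow> bool" where
  "q_commute k x y \<longleftrightarrow> x * y = v powi k * (y * x)"

lemma q_commute_sym:
  assumes "q_commute k x y"
  shows "q_commute (- k) y x"
  using assms vpow_add[of "- k" k] by (simp add: q_commute_def mult.assoc[symmetric])

lemma q_commute_1: "q_commute 0 1 y"
  by (simp add: q_commute_def)

lemma q_commute_mult:
  assumes "q_commute k x y" "q_commute l x' y"
  shows "q_commute (k + l) (x * x') y"
proof -
  have "x * x' * y = v powi l * (x * y * x')"
    using assms(2) by (simp add: q_commute_def mult.assoc vpow_left_commute)
  also have "x * y * x' = v powi k * (y * x) * x'"
    using assms(1) by (simp add: q_commute_def)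
  finally show ?thesis
    by (simp add: q_commute_def mult.assoc vpow_add add.commute[of k])
qed

lemma q_commute_inverse:
  assumes "q_commute k x y" "x \<noteq> 0"
  shows "q_commute (- k) (inverse x) y"
proof -
  have "inverse x * y = inverse x * (y * x) * inverse x"
    using assms(2) by (simp add: mult.assoc)
  also have "y * x = v powi (- k) * (x * y)"
    using q_commute_sym[OF assms(1)] by (simp add: q_commute_def)
  also have "inverse x * (v powi (- k) * (x * y)) * inverse x = v powi (- k) * (inverse x * x * y * inverse x)"
    by (simp only: vpow_left_commute mult.assoc)
  finally show ?thesis
    using assms(2) by (simp add: q_commute_def mult.assoc)
qed

lemma q_commute_powi:
  assumes "q_commute k x y" "x \<noteq> 0"
  shows "q_commute (a * k) (x powi a) y"
proof -
  have nat: "q_commute (int i * k) (x ^ i) y" for i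
  proof (induction i)
    case (Suc i)
    have "k + int i * k = int (Suc i) * k" by (simp add: algebra_simps)
    then show ?case
      using q_commute_mult[OF assms(1) Suc.IH] by (simp only: power_Suc)
  qed (simp add: q_commute_1)
  show ?thesis
  proof (cases a rule: int_cases2)
    case (nonneg i)
    then show ?thesis using nat by simp
  next
    case (nonpos i)
    then show ?thesis using q_commute_inverse[OF nat[of i]] assms(2) by (simp add: power_int_minus)
  qed
qed

end

text \<open>What the proof retains of a toric frame: a skew form, the product rule and independence
  of the monomials. The Z-monomials and the Y-monomials satisfy the same axioms, so one theory
  serves all three.\<close>

locale quantum_frame = central_unit v
  for v :: "'f::division_ring" +
  fixes m :: nat and M :: "ivec \<Rightarrow> 'f" and \<Lambda> :: "ivec \<Rightarrow> ivec \<Rightarrow> int"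
  assumes form_add: "c \<in> zvecs m \<Longrightarrow> c' \<in> zvecs m \<Longrightarrow> d \<in> zvecs m \<Longrightarrow> \<Lambda> (c + c') d = \<Lambda> c d + \<Lambda> c' d"
    and form_skew: "c \<in> zvecs m \<Longrightarrow> d \<in> zvecs m \<Longrightarrow> \<Lambda> c d = - \<Lambda> d c"
    and M_mult: "c \<in> zvecs m \<Longrightarrow> d \<in> zvecs m \<Longrightarrow> M c * M d = v powi \<Lambda> c d * M (c + d)"
    and M_independent: "inj_on (lincomb v M) {p. Poly_Mapping.keys p \<subseteq> zvecs m}"
begin

lemma form_add_right:
  "c \<in> zvecs m \<Longrightarrow> d \<in> zvecs m \<Longrightarrow> d' \<in> zvecs m \<Longrightarrow> \<Lambda> c (d + d') = \<Lambda> c d + \<Lambda> c d'"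
  using form_add[of d d' c] form_skew[of c "d + d'"] form_skew[of c d] form_skew[of c d'] by auto

lemma form_self: "c \<in> zvecs m \<Longrightarrow> \<Lambda> c c = 0"
  using form_skew[of c c] by simp

lemma form_0 [simp]:
  assumes "c \<in> zvecs m"
  shows "\<Lambda> 0 c = 0" "\<Lambda> c 0 = 0"
  using form_add[of 0 0 c] form_add_right[of c 0 0] assms by auto

lemma form_uminus:
  assumes "c \<in> zvecs m" "d \<in> zvecs m"
  shows "\<Lambda> (- c) d = - \<Lambda> c d" "\<Lambda> c (- d) = - \<Lambda> c d"
  using form_add[of c "- c" d] form_add_right[of c d "- d"] assms by (auto simp: zvecs_uminus)

lemma form_vscale:
  assumes "c \<in> zvecs m" "d \<in> zvecs m"
  shows "\<Lambda> (vscale s c) d = s * \<Lambda> c d"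
proof -
  have nat: "\<Lambda> (vscale (int k) c) d = int k * \<Lambda> c d" for k
    by (induction k) (use assms in \<open>auto simp: vscale_add_left form_add zvecs_vscale algebra_simps\<close>)
  show ?thesis
    by (cases s rule: int_cases2) (use assms nat in \<open>auto simp: form_uminus zvecs_vscale\<close>)
qed

lemma form_vscale_right:
  "c \<in> zvecs m \<Longrightarrow> d \<in> zvecs m \<Longrightarrow> \<Lambda> c (vscale s d) = s * \<Lambda> c d"
  using form_vscale[of d c s] form_skew[of c d] form_skew[of c "vscale s d"] by auto

lemma form_sum:
  assumes "\<And>i. i \<in> I \<Longrightarrow> c i \<in> zvecs m" "d \<in> zvecs m"
  shows "\<Lambda> (sum c I) d = (\<Sum>i\<in>I. \<Lambda> (c i) d)"
  using assms by (induction I rule: infinite_finite_induct) (auto simp: form_add zvecs_sum)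

lemma form_sum_right:
  assumes "\<And>i. i \<in> I \<Longrightarrow> d i \<in> zvecs m" "c \<in> zvecs m"
  shows "\<Lambda> c (sum d I) = (\<Sum>i\<in>I. \<Lambda> c (d i))"
  using assms by (induction I rule: infinite_finite_induct) (auto simp: form_add_right zvecs_sum)

lemma form_combination:
  assumes "\<And>i. i \<in> I \<Longrightarrow> c i \<in> zvecs m" "d \<in> zvecs m"
  shows "\<Lambda> (\<Sum>i\<in>I. vscale (a i) (c i)) d = (\<Sum>i\<in>I. a i * \<Lambda> (c i) d)"
    and "\<Lambda> d (\<Sum>i\<in>I. vscale (a i) (c i)) = (\<Sum>i\<in>I. a i * \<Lambda> d (c i))"
  using assms
  by (subst form_sum form_sum_right;
      auto simp: form_vscale form_vscale_right intro!: zvecs_vscale sum.cong)+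

lemma form_expand_right:
  assumes "c \<in> zvecs m" "d \<in> zvecs m"
  shows "\<Lambda> c d = (\<Sum>i\<in>{1..m}. Poly_Mapping.lookup d i * \<Lambda> c (unit_vec i))"
proof -
  have "\<Lambda> c (\<Sum>i\<in>{1..m}. vscale (Poly_Mapping.lookup d i) (unit_vec i)) =
      (\<Sum>i\<in>{1..m}. Poly_Mapping.lookup d i * \<Lambda> c (unit_vec i))"
    using assms by (subst form_sum_right) (auto intro!: sum.cong zvecs_vscale zvecs_unit form_vscale_right)
  then show ?thesis using zvecs_expand[OF assms(2)] by simp
qed

text \<open>Both sides are linear combinations with one basis element and one power of
  \<open>v\<close>; independence makes the coefficients, hence the powers, coincide. Thus
  \<open>v\<close> has infinite order and exponents can be read off from identities.\<close>

lemma M_monomial_inj: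
  assumes "c \<in> zvecs m" "v powi i * M c = v powi j * M c"
  shows "i = j"
proof -
  have "lincomb v M (Poly_Mapping.single c (Poly_Mapping.single l 1)) = v powi l * M c" for l
    by (simp add: lincomb_single qcoeff_eval_single)
  then have "Poly_Mapping.single c (Poly_Mapping.single i (1::int)) = Poly_Mapping.single c (Poly_Mapping.single j 1)"
    using assms by (intro inj_onD[OF M_independent]) auto
  then show ?thesis
    by (metis lookup_single_eq lookup_single_not_eq zero_neq_one)
qed

lemma M_nonzero:
  assumes "c \<in> zvecs m"
  shows "M c \<noteq> 0"
  \<comment> \<open>If \<open>M c\<close> vanished, the exponents 0 and 1 would give the same
    element.\<close>
  using M_monomial_inj[OF assms, of 0 1] by auto

lemma vpow_inj: "v powi i = v powi j \<Longrightarrow> i = j"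
  using M_monomial_inj[OF zvecs_0, of i j] by simp

lemma M_0 [simp]: "M 0 = 1"
  using M_mult[OF zvecs_0 zvecs_0] M_nonzero[OF zvecs_0] by simp

lemma M_add:
  assumes "c \<in> zvecs m" "d \<in> zvecs m"
  shows "M (c + d) = v powi (- \<Lambda> c d) * (M c * M d)"
  unfolding M_mult[OF assms] mult.assoc[symmetric] vpow_add[symmetric] by simp

lemma M_commute:
  assumes "c \<in> zvecs m" "d \<in> zvecs m"
  shows "M c * M d = v powi (2 * \<Lambda> c d) * (M d * M c)"
  unfolding M_mult[OF assms] M_mult[OF assms(2,1)] mult.assoc[symmetric] vpow_add[symmetric]
  using form_skew[OF assms] by (simp add: add.commute)

text \<open>The commutation relation of two frame elements already determines their form. This
  carries values of the form from one seed to another whenever the seeds share variables.\<close>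

lemma form_eq_if_commute:
  assumes "c \<in> zvecs m" "d \<in> zvecs m" and k: "M c * M d = v powi (2 * k) * (M d * M c)"
  shows "\<Lambda> c d = k"
proof -
  have "M d * M c \<noteq> 0" using assms M_nonzero by simp
  then have "v powi (2 * \<Lambda> c d) = v powi (2 * k)"
    using k unfolding M_commute[OF assms(1,2)] by simp
  then show ?thesis using vpow_inj by fastforce
qed

lemma M_vscale_nat:
  assumes "c \<in> zvecs m"
  shows "M (vscale (int k) c) = M c ^ k"
proof (induction k)
  case (Suc k)
  have "M (vscale (int k) c) * M c = M (vscale (int k) c + c)"
    using assms by (simp add: M_mult form_vscale form_self zvecs_vscale)
  also have "vscale (int k) c + c = vscale (int (Suc k)) c"
    using vscale_add_left[of "int k" 1 c] by (simp add: add.commute)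
  finally show ?case
    by (metis Suc.IH power_Suc2)
qed simp

lemma M_uminus:
  assumes "c \<in> zvecs m"
  shows "M (- c) = inverse (M c)"
proof -
  have "M c * M (- c) = 1"
    using assms M_mult[of c "- c"] by (simp add: form_uminus form_self zvecs_uminus)
  then show ?thesis by (metis inverse_unique)
qed

lemma M_vscale:
  assumes "c \<in> zvecs m"
  shows "M (vscale s c) = M c powi s"
  by (cases s rule: int_cases2)
    (use assms in \<open>auto simp: M_vscale_nat M_uminus zvecs_vscale power_int_minus\<close>)

lemma reindex:
  assumes "inj_on \<eta> (zvecs m')" "\<eta> ` zvecs m' \<subseteq> zvecs m"
    and "\<And>c d. c \<in> zvecs m' \<Longrightarrow> d \<in> zvecs m' \<Longrightarrow> \<eta> (c + d) = \<eta> c + \<eta> d"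
  shows "quantum_frame v m' (\<lambda>c. M (\<eta> c)) (\<lambda>c d. \<Lambda> (\<eta> c) (\<eta> d))"
proof
  show "inj_on (lincomb v (\<lambda>c. M (\<eta> c))) {p. Poly_Mapping.keys p \<subseteq> zvecs m'}"
    using inj_on_lincomb_reindex[OF M_independent assms(1,2)] .
qed (use assms in \<open>auto simp: v_nonzero v_central form_add M_mult image_subset_iff intro: form_skew\<close>)

end

lemma quantum_frame_cong:
  assumes "quantum_frame v m M \<Lambda>"
    and "\<And>c. c \<in> zvecs m \<Longrightarrow> M' c = M c"
    and "\<And>c d. c \<in> zvecs m \<Longrightarrow> d \<in> zvecs m \<Longrightarrow> \<Lambda>' c d = \<Lambda> c d"
  shows "quantum_frame v m M' \<Lambda>'"
proof -
  interpret quantum_frame v m M \<Lambda> by fact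
  have eq: "lincomb v M' p = lincomb v M p" if "Poly_Mapping.keys p \<subseteq> zvecs m" for p
    using that assms(2) by (intro lincomb_cong) auto
  show ?thesis
  proof
    show "inj_on (lincomb v M') {p. Poly_Mapping.keys p \<subseteq> zvecs m}"
      using M_independent eq by (subst inj_on_cong[where g = "lincomb v M"]) auto
  qed (use assms(2,3) in \<open>auto simp: v_nonzero v_central form_add M_mult zvecs_add intro: form_skew\<close>)
qed

text \<open>Independence of the basis of the quantum torus survives both maps: \<eta> is injective
  on exponents, and \<phi> is injective and linear over the coefficients.\<close>

lemma toric_frame_is_quantum_frame:
  assumes amb: "ambient_skew_field v \<Lambda>L X" and tf: "toric_frame v \<Lambda>L X m M \<Lambda>M"
  shows "quantum_frame v m M \<Lambda>M"
proof -
  obtain \<phi> \<eta> where \<phi>: "skew_field_automorphism v \<phi>" and \<eta>: "lattice_isomorphism m \<eta>"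
    and M: "\<And>c. c \<in> zvecs m \<Longrightarrow> M c = \<phi> (X (\<eta> c))"
    and \<Lambda>M: "\<And>c d. c \<in> zvecs m \<Longrightarrow> d \<in> zvecs m \<Longrightarrow> \<Lambda>M c d = \<Lambda>L (\<eta> c) (\<eta> d)"
    using tf unfolding toric_frame_def by blast
  have addL: "\<Lambda>L (e + f) h = \<Lambda>L e h + \<Lambda>L f h" and skewL: "\<Lambda>L e f = - \<Lambda>L f e" and frac: "fractions_of_span v UNIV X"
    and Xmult: "X e * X f = v powi \<Lambda>L e f * X (e + f)" for e f h
    using amb unfolding ambient_skew_field_def skew_bilinear_form_def by blast+
  have \<eta>_add: "\<eta> (c + d) = \<eta> c + \<eta> d" if "c \<in> zvecs m" "d \<in> zvecs m" for c d
    using \<eta> that by (auto simp: lattice_isomorphism_def)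
  have mult: "\<phi> (x * y) = \<phi> x * \<phi> y" and \<phi>_inj: "inj \<phi>" for x y
    using \<phi> by (auto simp: skew_field_automorphism_def bij_def)
  have \<phi>_vpow: "\<phi> (v powi k * X e) = v powi k * \<phi> (X e)" for k e
    using skew_field_automorphism_lincomb[OF \<phi>, of X "Poly_Mapping.single e (Poly_Mapping.single k 1)"]
    by (simp add: lincomb_single qcoeff_eval_single)
  show ?thesis
  proof
    show "v \<noteq> 0" "\<And>z. v * z = z * v"
      using frac by (auto simp: fractions_of_span_def)
    show "\<Lambda>M (c + c') d = \<Lambda>M c d + \<Lambda>M c' d" if "c \<in> zvecs m" "c' \<in> zvecs m" "d \<in> zvecs m" for c c' d
      using that by (simp add: \<Lambda>M \<eta>_add zvecs_add addL)
    show "\<Lambda>M c d = - \<Lambda>M d c" if "c \<in> zvecs m" "d \<in> zvecs m" for c d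
      using that \<Lambda>M skewL[of "\<eta> c" "\<eta> d"] by simp
    show "M c * M d = v powi \<Lambda>M c d * M (c + d)" if "c \<in> zvecs m" "d \<in> zvecs m" for c d
      using that by (simp add: M \<Lambda>M zvecs_add \<eta>_add mult[symmetric] Xmult \<phi>_vpow)
    have "inj_on (lincomb v (\<lambda>c. X (\<eta> c))) {p. Poly_Mapping.keys p \<subseteq> zvecs m}"
      using inj_on_lincomb_reindex[of v X UNIV \<eta> "zvecs m"] frac \<eta>
      by (auto simp: fractions_of_span_def lattice_isomorphism_def bij_betw_def)
    then have "inj_on (\<phi> \<circ> lincomb v (\<lambda>c. X (\<eta> c))) {p. Poly_Mapping.keys p \<subseteq> zvecs m}"
      by (rule comp_inj_on) (use \<phi>_inj inj_on_subset in blast)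
    moreover have "(\<phi> \<circ> lincomb v (\<lambda>c. X (\<eta> c))) p = lincomb v M p" if "Poly_Mapping.keys p \<subseteq> zvecs m" for p
      using that M unfolding comp_def skew_field_automorphism_lincomb[OF \<phi>]
      by (intro lincomb_cong) (auto simp: M)
    ultimately show "inj_on (lincomb v M) {p. Poly_Mapping.keys p \<subseteq> zvecs m}"
      using inj_on_cong[of "{p. Poly_Mapping.keys p \<subseteq> zvecs m}" "\<phi> \<circ> lincomb v (\<lambda>c. X (\<eta> c))" "lincomb v M"]
      by blast
  qed
qed

section \<open>Monomials in a quantum torus\<close>

text \<open>Half of the commutation exponents of the generators, measured in powers of
  \<open>v\<close> and extended bilinearly. The scalar in \<open>torus_monomial\<close> is the one
  for which products of monomials follow exactly this form.\<close>

definition torus_form :: "nat \<Rightarrow> (nat \<Rightarrow> int) \<Rightarrow> imat \<Rightarrow> ivec \<Rightarrow> ivec \<Rightarrow> int" where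
  "torus_form n d B0 c e = (\<Sum>i\<in>{1..n}. \<Sum>j\<in>{1..n}.
     d i * B0 i j * Poly_Mapping.lookup c i * Poly_Mapping.lookup e j)"

lemma torus_monomial_Suc:
  assumes "(v::'f::division_ring) \<noteq> 0"
  shows "torus_monomial (Suc n) d B0 v Z c =
    v powi (\<Sum>i\<in>{1..n}. d (Suc n) * B0 (Suc n) i * Poly_Mapping.lookup c i * Poly_Mapping.lookup c (Suc n))
      * torus_monomial n d B0 v Z c * Z (Suc n) powi Poly_Mapping.lookup c (Suc n)"
proof -
  let ?f = "\<lambda>j i. d j * B0 j i * Poly_Mapping.lookup c i * Poly_Mapping.lookup c j"
  have "(\<Sum>j\<in>{1..Suc n}. sum (?f j) {1..<j}) = sum (?f (Suc n)) {1..n} + (\<Sum>j\<in>{1..n}. sum (?f j) {1..<j})"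
    by (simp add: atLeastLessThanSuc_atLeastAtMost)
  then show ?thesis
    using assms by (simp add: torus_monomial_def power_int_add mult.assoc del: sum.cl_ivl_Suc)
qed

lemma torus_monomial_0 [simp]: "torus_monomial 0 d B0 v Z c = 1"
  by (simp add: torus_monomial_def)

lemma torus_form_Suc:
  "torus_form (Suc n) d B0 c e = torus_form n d B0 c e
     + (\<Sum>i\<in>{1..n}. d i * B0 i (Suc n) * Poly_Mapping.lookup c i * Poly_Mapping.lookup e (Suc n))
     + (\<Sum>i\<in>{1..n}. d (Suc n) * B0 (Suc n) i * Poly_Mapping.lookup c (Suc n) * Poly_Mapping.lookup e i)
     + d (Suc n) * B0 (Suc n) (Suc n) * Poly_Mapping.lookup c (Suc n) * Poly_Mapping.lookup e (Suc n)"
  by (simp add: torus_form_def sum.distrib)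

lemma torus_form_add: "torus_form n d B0 (c + c') e = torus_form n d B0 c e + torus_form n d B0 c' e"
  by (simp add: torus_form_def lookup_add algebra_simps sum.distrib)

lemma torus_form_skew:
  assumes "\<forall>i\<in>{1..n}. \<forall>j\<in>{1..n}. d i * B0 i j = - (d j * B0 j i)"
  shows "torus_form n d B0 c e = - torus_form n d B0 e c"
proof -
  have "torus_form n d B0 c e =
      (\<Sum>j\<in>{1..n}. \<Sum>i\<in>{1..n}. d i * B0 i j * Poly_Mapping.lookup c i * Poly_Mapping.lookup e j)"
    unfolding torus_form_def by (rule sum.swap)
  also have "\<dots> = (\<Sum>j\<in>{1..n}. \<Sum>i\<in>{1..n}. - (d j * B0 j i * Poly_Mapping.lookup e j * Poly_Mapping.lookup c i))"
  proof (intro sum.cong refl)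
    fix i j assume "i \<in> {1..n}" "j \<in> {1..n}"
    then have "d i * B0 i j = - (d j * B0 j i)" using assms by blast
    then show "d i * B0 i j * Poly_Mapping.lookup c i * Poly_Mapping.lookup e j =
        - (d j * B0 j i * Poly_Mapping.lookup e j * Poly_Mapping.lookup c i)"
      by simp
  qed
  finally show ?thesis
    by (simp add: torus_form_def sum_negf)
qed

context central_unit
begin

lemma q_commute_torus_monomial:
  assumes "\<forall>i\<in>{1..n}. Z i \<noteq> 0 \<and> q_commute (2 * k i) (Z i) y"
  shows "q_commute (2 * (\<Sum>i\<in>{1..n}. k i * Poly_Mapping.lookup c i)) (torus_monomial n d B0 v Z c) y"
  using assms
proof (induction n)
  case 0
  then show ?case by (simp add: q_commute_1)
next
  case (Suc n)
  let ?s = "\<Sum>i\<in>{1..n}. d (Suc n) * B0 (Suc n) i * Poly_Mapping.lookup c i * Poly_Mapping.lookup c (Suc n)"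
  have IH: "q_commute (2 * (\<Sum>i\<in>{1..n}. k i * Poly_Mapping.lookup c i)) (torus_monomial n d B0 v Z c) y"
    using Suc.prems by (intro Suc.IH) auto
  have v: "q_commute 0 (v powi ?s) y"
    using vpow_central by (simp add: q_commute_def)
  have Z: "q_commute (Poly_Mapping.lookup c (Suc n) * (2 * k (Suc n))) (Z (Suc n) powi Poly_Mapping.lookup c (Suc n)) y"
    using Suc.prems by (intro q_commute_powi) auto
  have eq: "2 * (\<Sum>i\<in>{1..Suc n}. k i * Poly_Mapping.lookup c i) =
      0 + 2 * (\<Sum>i\<in>{1..n}. k i * Poly_Mapping.lookup c i) + Poly_Mapping.lookup c (Suc n) * (2 * k (Suc n))"
    by simp
  show ?case
    unfolding torus_monomial_Suc[OF v_nonzero] eq by (intro q_commute_mult v IH Z)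
qed

text \<open>Induction on the rank. Only the last generator of the left factor must be moved, past
  the first n generators of the right factor; all other reordering is in the induction
  hypothesis.\<close>

lemma torus_monomial_mult:
  assumes "\<forall>i\<in>{1..n}. Z i \<noteq> 0"
    and "\<forall>i\<in>{1..n}. \<forall>j\<in>{1..n}. q_commute (2 * (d i * B0 i j)) (Z i) (Z j)"
    and "\<forall>i\<in>{1..n}. \<forall>j\<in>{1..n}. d i * B0 i j = - (d j * B0 j i)"
  shows "torus_monomial n d B0 v Z c * torus_monomial n d B0 v Z e =
    v powi torus_form n d B0 c e * torus_monomial n d B0 v Z (c + e)"
  using assms
proof (induction n)
  case 0
  show ?case by (simp add: torus_form_def)
next
  case (Suc n)
  let ?N = "Suc n"
  let ?T = "torus_monomial n d B0 v Z"
  let ?c = "Poly_Mapping.lookup c" and ?e = "Poly_Mapping.lookup e"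
  define s where "s f = (\<Sum>i\<in>{1..n}. d ?N * B0 ?N i * Poly_Mapping.lookup f i * Poly_Mapping.lookup f ?N)" for f
  have T_Suc: "torus_monomial ?N d B0 v Z f = v powi s f * (?T f * Z ?N powi Poly_Mapping.lookup f ?N)" for f
    unfolding torus_monomial_Suc[OF v_nonzero] s_def mult.assoc ..
  define r where "r = 2 * (\<Sum>i\<in>{1..n}. d i * B0 i ?N * ?e i)"
  have IH: "?T c * ?T e = v powi torus_form n d B0 c e * ?T (c + e)"
  proof (rule Suc.IH)
    show "\<forall>i\<in>{1..n}. Z i \<noteq> 0"
      "\<forall>i\<in>{1..n}. \<forall>j\<in>{1..n}. q_commute (2 * (d i * B0 i j)) (Z i) (Z j)"
      using Suc.prems(1,2) by auto
    show "\<forall>i\<in>{1..n}. \<forall>j\<in>{1..n}. d i * B0 i j = - (d j * B0 j i)"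
      using Suc.prems(3) by (meson atLeastAtMost_iff le_Suc_eq)
  qed
  have "q_commute r (?T e) (Z ?N)"
    unfolding r_def using Suc.prems(1,2) by (intro q_commute_torus_monomial) auto
  then have "q_commute (?c ?N * (- r)) (Z ?N powi ?c ?N) (?T e)"
    using Suc.prems(1) by (intro q_commute_powi q_commute_sym) auto
  then have comm: "Z ?N powi ?c ?N * ?T e = v powi (?c ?N * (- r)) * (?T e * Z ?N powi ?c ?N)"
    by (simp add: q_commute_def)
  have "torus_monomial ?N d B0 v Z c * torus_monomial ?N d B0 v Z e
      = v powi s c * (v powi s e * (?T c * (Z ?N powi ?c ?N * ?T e) * Z ?N powi ?e ?N))"
    unfolding T_Suc mult.assoc
    by (simp only: vpow_left_commute[of "?T c"] vpow_left_commute[of "Z ?N powi ?c ?N"])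
  also have "\<dots> = v powi s c * (v powi s e * (v powi (?c ?N * (- r)) *
      ((?T c * ?T e) * (Z ?N powi ?c ?N * Z ?N powi ?e ?N))))"
    unfolding comm mult.assoc by (simp only: vpow_left_commute[of "?T c"])
  also have "\<dots> = v powi (s c + s e + ?c ?N * (- r) + torus_form n d B0 c e) *
      (?T (c + e) * Z ?N powi (?c ?N + ?e ?N))"
    using Suc.prems(1) unfolding IH vpow_add mult.assoc by (simp add: power_int_add)
  \<comment> \<open>By skewness the mixed terms with c_i e_N cancel between the form and
    \<open>s (c + e)\<close>, those with c_N e_i double, and the diagonal term is zero. The doubled
    terms are the cost of moving the last generator.\<close>
  also have "s c + s e + ?c ?N * (- r) + torus_form n d B0 c e = torus_form ?N d B0 c e + s (c + e)"
  proof -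
    have B0: "d i * B0 i ?N = - (d ?N * B0 ?N i)" if "i \<in> {1..n}" for i
      using Suc.prems(3)[rule_format, of i ?N] that by simp
    have "d ?N * B0 ?N ?N = - (d ?N * B0 ?N ?N)"
      using Suc.prems(3)[rule_format, of ?N ?N] by simp
    then have NN: "d ?N * B0 ?N ?N = 0" by linarith
    have 1: "?c ?N * (- r) = (\<Sum>i\<in>{1..n}. 2 * (d ?N * B0 ?N i * ?c ?N * ?e i))"
      unfolding r_def sum_distrib_left sum_negf[symmetric]
      by (intro sum.cong refl) (simp add: B0)
    have 2: "(\<Sum>i\<in>{1..n}. d i * B0 i ?N * ?c i * ?e ?N) = (\<Sum>i\<in>{1..n}. - (d ?N * B0 ?N i * ?c i * ?e ?N))"
      by (intro sum.cong refl) (simp add: B0)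
    show ?thesis
      unfolding torus_form_Suc 1 2 NN s_def lookup_add
      by (simp add: sum.distrib[symmetric] sum_subtractf[symmetric] sum_negf[symmetric] algebra_simps)
  qed
  finally show ?case
    unfolding T_Suc lookup_add vpow_add mult.assoc .
qed

end

text \<open>When the frame elements have the commutation relations of the generators of R, the
  normalising scalar cancels the reordering scalars of the frame. Monomials in the Y variables
  thereby become single values of \<open>M0\<close>.\<close>

lemma (in quantum_frame) torus_monomial_frame:
  assumes "\<forall>i\<in>{1..n}. u i \<in> zvecs m"
    and "\<forall>i\<in>{1..n}. \<forall>j\<in>{1..n}. \<Lambda> (u i) (u j) = d i * B0 i j"
  shows "torus_monomial n d B0 v (\<lambda>i. M (u i)) c = M (\<Sum>l\<in>{1..n}. vscale (Poly_Mapping.lookup c l) (u l))"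
  using assms
proof (induction n)
  case (Suc n)
  let ?N = "Suc n"
  let ?c = "Poly_Mapping.lookup c"
  define S where "S = (\<Sum>l\<in>{1..n}. vscale (?c l) (u l))"
  have IH: "torus_monomial n d B0 v (\<lambda>i. M (u i)) c = M S"
    unfolding S_def using Suc.prems by (intro Suc.IH) auto
  have S: "S \<in> zvecs m"
    unfolding S_def using Suc.prems by (intro zvecs_sum zvecs_vscale) auto
  have N: "u ?N \<in> zvecs m" using Suc.prems by auto
  have "\<Lambda> S (u ?N) = (\<Sum>l\<in>{1..n}. ?c l * \<Lambda> (u l) (u ?N))"
    unfolding S_def using Suc.prems by (subst form_sum) (auto simp: form_vscale zvecs_vscale)
  also have "\<dots> = (\<Sum>l\<in>{1..n}. - (d ?N * B0 ?N l * ?c l))"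
  proof (intro sum.cong refl)
    fix l assume "l \<in> {1..n}"
    then have "\<Lambda> (u l) (u ?N) = - (d ?N * B0 ?N l)"
      using Suc.prems(1) Suc.prems(2)[rule_format, of ?N l] form_skew[of "u l" "u ?N"] by auto
    then show "?c l * \<Lambda> (u l) (u ?N) = - (d ?N * B0 ?N l * ?c l)" by simp
  qed
  finally have "\<Lambda> S (vscale (?c ?N) (u ?N)) = - (\<Sum>l\<in>{1..n}. d ?N * B0 ?N l * ?c l * ?c ?N)"
    by (simp add: form_vscale_right S N sum_negf sum_distrib_left sum_distrib_right mult_ac)
  then have "M (S + vscale (?c ?N) (u ?N)) =
      v powi (\<Sum>l\<in>{1..n}. d ?N * B0 ?N l * ?c l * ?c ?N) * (M S * M (vscale (?c ?N) (u ?N)))"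
    using S N by (simp add: M_add zvecs_vscale)
  then show ?case
    by (simp add: torus_monomial_Suc[OF v_nonzero] IH M_vscale N mult.assoc S_def[symmetric, simplified])
qed simp

lemma torus_skew_field_frame:
  assumes R: "torus_skew_field n d B0 w Z"
    and B0: "\<forall>i\<in>{1..n}. \<forall>j\<in>{1..n}. d i * B0 i j = - (d j * B0 j i)"
  shows "quantum_frame w n (torus_monomial n d B0 w Z) (torus_form n d B0)"
proof -
  interpret central_unit w
    using R by unfold_locales (auto simp: torus_skew_field_def fractions_of_span_def)
  show ?thesis
  proof
    show "torus_form n d B0 c e = - torus_form n d B0 e c" for c e
      using torus_form_skew[OF B0] .
    show "torus_monomial n d B0 w Z c * torus_monomial n d B0 w Z e =
        w powi torus_form n d B0 c e * torus_monomial n d B0 w Z (c + e)" for c e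
      by (rule torus_monomial_mult[OF _ _ B0]) (use R in \<open>unfold torus_skew_field_def q_commute_def, blast+\<close>)
    show "inj_on (lincomb w (torus_monomial n d B0 w Z)) {p. Poly_Mapping.keys p \<subseteq> zvecs n}"
      using R by (auto simp: torus_skew_field_def fractions_of_span_def)
  qed (rule torus_form_add)
qed

lemma of_int_left_commute: "x * (of_int a * y) = of_int a * (x * y)" for x y :: "'a::ring_1"
  by (simp only: mult.assoc[symmetric] mult_of_int_commute[of a x])

section \<open>Substitution into another quantum torus\<close>

text \<open>Source and target carry the same form. Equal structure constants are what makes the
  transfer of coefficients multiplicative.\<close>

locale torus_transfer =
  source: quantum_frame w n "torus_monomial n d B0 w Z" "torus_form n d B0" +
  target: quantum_frame v n "torus_monomial n d B0 v Y" "torus_form n d B0"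
  for n :: nat and d :: "nat \<Rightarrow> int" and B0 :: imat
    and w :: "'k::division_ring" and Z :: "nat \<Rightarrow> 'k"
    and v :: "'f::division_ring" and Y :: "nat \<Rightarrow> 'f"
begin

abbreviation "ZM \<equiv> torus_monomial n d B0 w Z"
abbreviation "YM \<equiv> torus_monomial n d B0 v Y"
abbreviation "coeffs \<equiv> torus_coeffs n d B0 w Z"
abbreviation "subst \<equiv> torus_subst n d B0 w Z v Y"
abbreviation "L \<equiv> torus_L n d B0 w Z"

definition torus :: "'k set" where
  "torus = lincomb w ZM ` {p. Poly_Mapping.keys p \<subseteq> zvecs n}"

text \<open>
  Closure properties are proved for pairs with equal coefficients, which avoids computing the
  coefficients of a product.
\<close>

definition corresponds :: "'k \<Rightarrow> 'f \<Rightarrow> bool" where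
  "corresponds x y \<longleftrightarrow>
     (\<exists>p. Poly_Mapping.keys p \<subseteq> zvecs n \<and> x = lincomb w ZM p \<and> y = lincomb v YM p)"

lemma coeffs_lincomb:
  assumes "Poly_Mapping.keys p \<subseteq> zvecs n"
  shows "coeffs (lincomb w ZM p) = p"
  unfolding torus_coeffs_def
  by (rule the_equality) (use assms inj_onD[OF source.M_independent] in auto)

lemma coeffs:
  assumes "x \<in> torus"
  shows "Poly_Mapping.keys (coeffs x) \<subseteq> zvecs n" "lincomb w ZM (coeffs x) = x"
  using assms by (auto simp: torus_def coeffs_lincomb)

lemma corresponds_iff: "corresponds x y \<longleftrightarrow> x \<in> torus \<and> subst x = y"
  unfolding corresponds_def torus_def torus_subst_def by (auto simp: coeffs_lincomb)

text \<open>The monomials \<open>YM\<close> are independent as well, so coefficients can be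
  recovered after substitution. This brings identities between cluster variables back to R.\<close>

lemma subst_inj:
  assumes "x \<in> torus" "x' \<in> torus" "subst x = subst x'"
  shows "x = x'"
proof -
  have "coeffs x = coeffs x'"
    using assms coeffs(1) by (intro inj_onD[OF target.M_independent]) (auto simp: torus_subst_def)
  then have "lincomb w ZM (coeffs x) = lincomb w ZM (coeffs x')"
    by (simp only:)
  then show ?thesis
    by (simp only: coeffs(2) assms(1,2))
qed

lemma corresponds_add:
  assumes "corresponds x y" "corresponds x' y'"
  shows "corresponds (x + x') (y + y')"
proof -
  obtain p where p: "Poly_Mapping.keys p \<subseteq> zvecs n" "x = lincomb w ZM p" "y = lincomb v YM p"
    using assms(1) unfolding corresponds_def by (elim exE conjE)
  obtain p' where p': "Poly_Mapping.keys p' \<subseteq> zvecs n" "x' = lincomb w ZM p'" "y' = lincomb v YM p'"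
    using assms(2) unfolding corresponds_def by (elim exE conjE)
  show ?thesis
    unfolding corresponds_def using p p'
    by (intro exI[of _ "p + p'"]) (auto simp: lincomb_add dest!: subsetD[OF keys_add])
qed

lemma corresponds_0: "corresponds 0 0"
  unfolding corresponds_def by (intro exI[of _ 0]) simp

lemma corresponds_sum:
  "(\<And>i. i \<in> I \<Longrightarrow> corresponds (f i) (h i)) \<Longrightarrow> corresponds (sum f I) (sum h I)"
  by (induction I rule: infinite_finite_induct) (auto simp: corresponds_0 corresponds_add)

lemma corresponds_term:
  "c \<in> zvecs n \<Longrightarrow> corresponds (of_int a * w powi k * ZM c) (of_int a * v powi k * YM c)"
  unfolding corresponds_def
  by (intro exI[of _ "Poly_Mapping.single c (Poly_Mapping.single k a)"])
    (auto simp: lincomb_single qcoeff_eval_single)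

text \<open>The factor \<open>h c\<close> only shifts the power of \<open>v\<close> in each term, in
  the same way on both sides. With the twist of L[a] for \<open>h\<close>, this describes L[a] after
  substitution.\<close>

lemma corresponds_twist:
  assumes "Poly_Mapping.keys p \<subseteq> zvecs n"
  shows "corresponds (lincomb w (\<lambda>c. w powi h c * ZM c) p) (lincomb v (\<lambda>c. v powi h c * YM c) p)"
proof -
  have "corresponds (of_int a * w powi k * (w powi h c * ZM c)) (of_int a * v powi k * (v powi h c * YM c))"
    if "c \<in> Poly_Mapping.keys p" for a k c
    using corresponds_term[of c a "k + h c"] that assms
    unfolding source.vpow_add target.vpow_add mult.assoc by blast
  then show ?thesis
    unfolding lincomb_def qcoeff_eval_def sum_distrib_right by (intro corresponds_sum)
qed

lemma corresponds_mult:
  assumes "corresponds x y" "corresponds x' y'"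
  shows "corresponds (x * x') (y * y')"
proof -
  obtain p where p: "Poly_Mapping.keys p \<subseteq> zvecs n" "x = lincomb w ZM p" "y = lincomb v YM p"
    using assms(1) unfolding corresponds_def by (elim exE conjE)
  obtain p' where p': "Poly_Mapping.keys p' \<subseteq> zvecs n" "x' = lincomb w ZM p'" "y' = lincomb v YM p'"
    using assms(2) unfolding corresponds_def by (elim exE conjE)
  \<comment> \<open>For single terms the product is again a single term, with the exponent shifted
    by the common form; the general case follows by distributing both sums.\<close>
  have atom: "corresponds (of_int a * w powi k * ZM c * (of_int a' * w powi k' * ZM c'))
      (of_int a * v powi k * YM c * (of_int a' * v powi k' * YM c'))"
    if "c \<in> zvecs n" "c' \<in> zvecs n" for a k c a' k' c'
  proof -
    have "of_int a * w powi k * ZM c * (of_int a' * w powi k' * ZM c')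
        = of_int a * of_int a' * w powi k * w powi k' * (ZM c * ZM c')"
      by (simp only: mult.assoc of_int_left_commute[of "w powi k"] of_int_left_commute[of "ZM c"] source.vpow_left_commute[of "ZM c"])
    moreover have "of_int a * v powi k * YM c * (of_int a' * v powi k' * YM c')
        = of_int a * of_int a' * v powi k * v powi k' * (YM c * YM c')"
      by (simp only: mult.assoc of_int_left_commute[of "v powi k"] of_int_left_commute[of "YM c"] target.vpow_left_commute[of "YM c"])
    ultimately show ?thesis
      using corresponds_term[of "c + c'" "a * a'" "k + k' + torus_form n d B0 c c'"] that
      unfolding source.M_mult[OF that] target.M_mult[OF that] source.vpow_add target.vpow_add mult.assoc of_int_mult
      by (auto simp: zvecs_add)
  qed
  then show ?thesis
    unfolding p(2,3) p'(2,3) lincomb_def qcoeff_eval_def sum_distrib_right sum_distrib_left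
    using p(1) p'(1) by (intro corresponds_sum atom) auto
qed

lemma torus_subst_add:
  assumes "x \<in> torus" "x' \<in> torus"
  shows "x + x' \<in> torus" "subst (x + x') = subst x + subst x'"
  using corresponds_add[of x "subst x" x' "subst x'"] assms by (auto simp: corresponds_iff)

lemma torus_subst_mult:
  assumes "x \<in> torus" "x' \<in> torus"
  shows "x * x' \<in> torus" "subst (x * x') = subst x * subst x'"
  using corresponds_mult[of x "subst x" x' "subst x'"] assms by (auto simp: corresponds_iff)

lemma torus_subst_monomial:
  assumes "c \<in> zvecs n"
  shows "w powi k * ZM c \<in> torus" "subst (w powi k * ZM c) = v powi k * YM c"
  using corresponds_term[OF assms, of 1 k] by (auto simp: corresponds_iff)

lemma torus_subst_ZM:
  assumes "c \<in> zvecs n"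
  shows "ZM c \<in> torus" "subst (ZM c) = YM c"
  using torus_subst_monomial[OF assms, of 0] by auto

lemma torus_subst_vpow: "w powi k \<in> torus" "subst (w powi k) = v powi k"
  using torus_subst_monomial[of 0 k] by auto

lemma torus_subst_1: "1 \<in> torus" "subst 1 = 1"
  using torus_subst_vpow[of 0] by auto

lemma torus_prod_list:
  assumes "\<And>x. x \<in> set xs \<Longrightarrow> f x \<in> torus"
  shows "prod_list (map f xs) \<in> torus"
  using assms by (induction xs) (auto simp: torus_subst_1 torus_subst_mult)

lemma torus_polynomials_subset: "torus_polynomials n d B0 w Z \<subseteq> torus"
  unfolding torus_polynomials_def torus_def by (rule image_mono) auto

text \<open>The exponent of L[a] in powers of \<open>v\<close>, hence the factor 2. The floor in
  \<open>q_power\<close> is exact here, its argument being an integer.\<close>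

definition twist :: "ivec \<Rightarrow> ivec \<Rightarrow> int" where
  "twist a c = - 2 * (\<Sum>i\<in>{1..n}. Poly_Mapping.lookup a i * Poly_Mapping.lookup c i * d i)"

lemma torus_L_twist: "L a x = lincomb w (\<lambda>c. w powi twist a c * ZM c) (coeffs x)"
proof -
  have "q_power w (- rat_of_int s) = w powi (- 2 * s)" for s :: int
  proof -
    have "2 * (- of_int s) = (of_int (- 2 * s) :: rat)" by simp
    then show ?thesis unfolding q_power_def by (simp only: floor_of_int)
  qed
  then show ?thesis unfolding torus_L_def twist_def by (simp only:)
qed

lemma torus_L_closed:
  assumes "x \<in> torus"
  shows "L a x \<in> torus" "subst (L a x) = lincomb v (\<lambda>c. v powi twist a c * YM c) (coeffs x)"
  using corresponds_twist[OF coeffs(1)[OF assms], of "twist a"]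
  by (auto simp: torus_L_twist corresponds_iff)

text \<open>Coefficients are central, so it suffices that \<open>N\<close> passes each monomial at
  the cost of its eigenvalue under L[a]. Values of \<open>M0\<close> will take the place of
  \<open>N\<close>.\<close>

lemma subst_torus_L:
  assumes N: "\<And>c. c \<in> zvecs n \<Longrightarrow> target.q_commute (twist a c) N (YM c)" and x: "x \<in> torus"
  shows "N * subst x = subst (L a x) * N"
  unfolding torus_L_closed(2)[OF x] torus_subst_def[of n d B0 w Z v Y x] lincomb_def sum_distrib_left sum_distrib_right
proof (intro sum.cong refl)
  fix c assume "c \<in> Poly_Mapping.keys (coeffs x)"
  then have c: "N * YM c = v powi twist a c * (YM c * N)"
    using N coeffs(1)[OF x] by (auto simp: target.q_commute_def)
  have central: "N * (qcoeff_eval v b * y) = qcoeff_eval v b * (N * y)" for b y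
    unfolding mult.assoc[symmetric] central_qcoeff_eval[OF target.v_central, of b N, symmetric] ..
  show "N * (qcoeff_eval v (Poly_Mapping.lookup (coeffs x) c) * YM c) =
      qcoeff_eval v (Poly_Mapping.lookup (coeffs x) c) * (v powi twist a c * YM c) * N"
    unfolding central c mult.assoc ..
qed

end

section \<open>The labelled tree and matrix patterns\<close>

lemma tree_edge_sym: "tree_edge n k t t' \<Longrightarrow> tree_edge n k t' t"
  by (auto simp: tree_edge_def)

lemma tree_edge_vertices: "tree_edge n k t t' \<Longrightarrow> t \<in> tree_vertices n \<and> t' \<in> tree_vertices n \<and> k \<in> {1..n}"
  by (auto simp: tree_edge_def)

text \<open>Connectedness of the tree. Since edges are symmetric, \<open>step\<close> is an
  equivalence along each edge, and removing leading letters links every vertex to the empty word;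
  hence any vertex may serve as base.\<close>

lemma tree_induct:
  assumes t: "t0 \<in> tree_vertices n" "t \<in> tree_vertices n" and P0: "P t0"
    and step: "\<And>k t t'. tree_edge n k t t' \<Longrightarrow> P t \<Longrightarrow> P t'"
  shows "P t"
proof -
  have "s \<in> tree_vertices n \<Longrightarrow> P s \<longleftrightarrow> P []" for s
  proof (induction s)
    case (Cons k s)
    then have s: "s \<in> tree_vertices n"
      by (auto simp: tree_vertices_def dest: distinct_adj_ConsD)
    then have "tree_edge n k s (k # s)"
      using Cons.prems by (auto simp: tree_edge_def tree_vertices_def)
    then have "P s \<longleftrightarrow> P (k # s)"
      using step tree_edge_sym by blast
    then show ?case using Cons.IH[OF s] by simp
  qed simp
  then show ?thesis using t P0 by blast
qed

text \<open>Mutation determines the relevant entries from the initial matrix. This identifies the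
  exchange matrices hidden in the existential quantifier of \<open>is_g_vectors\<close> with those
  of the quantum pattern.\<close>

lemma principal_pattern_unique:
  assumes t0: "t0 \<in> tree_vertices n" and t: "t \<in> tree_vertices n"
    and b: "is_principal_matrix n B0 (b t0)"
      "\<And>k t t'. tree_edge n k t t' \<Longrightarrow> matrix_mutation (2*n) n k (b t) (b t')"
    and b': "is_principal_matrix n B0 (b' t0)"
      "\<And>k t t'. tree_edge n k t t' \<Longrightarrow> matrix_mutation (2*n) n k (b' t) (b' t')"
  shows "\<forall>i\<in>{1..2*n}. \<forall>j\<in>{1..n}. b t i j = b' t i j"
  using t0 t
proof (rule tree_induct[where P = "\<lambda>t. \<forall>i\<in>{1..2*n}. \<forall>j\<in>{1..n}. b t i j = b' t i j"])
  show "\<forall>i\<in>{1..2*n}. \<forall>j\<in>{1..n}. b t0 i j = b' t0 i j"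
  proof (intro ballI)
    fix i j assume i: "i \<in> {1..2*n}" and j: "j \<in> {1..n}"
    show "b t0 i j = b' t0 i j"
    proof (cases "i \<le> n")
      case True
      then show ?thesis using b(1) b'(1) i j by (simp add: is_principal_matrix_def)
    next
      case False
      then obtain l where "i = n + l" "l \<in> {1..n}"
        using i by (intro that[of "i - n"]) auto
      then show ?thesis using b(1) b'(1) j by (simp add: is_principal_matrix_def)
    qed
  qed
next
  fix k t t' assume e: "tree_edge n k t t'" and IH: "\<forall>i\<in>{1..2*n}. \<forall>j\<in>{1..n}. b t i j = b' t i j"
  have k: "k \<in> {1..n}" "k \<in> {1..2*n}"
    using tree_edge_vertices[OF e] by auto
  show "\<forall>i\<in>{1..2*n}. \<forall>j\<in>{1..n}. b t' i j = b' t' i j"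
    using b(2)[OF e] b'(2)[OF e] IH k by (simp add: matrix_mutation_def mutate_entry_def)
qed

lemma sum_atLeastAtMost_double:
  fixes f :: "nat \<Rightarrow> 'a::comm_monoid_add"
  shows "(\<Sum>i\<in>{1..2*n}. f i) = (\<Sum>i\<in>{1..n}. f i) + (\<Sum>i\<in>{1..n}. f (n + i))"
  using sum.ub_add_nat[of 1 n f n] sum.shift_bounds_cl_nat_ivl[of f 1 n n]
  by (simp add: mult_2 add.commute)

section \<open>Homogeneity and g-vectors\<close>

lemma laurent_fract_mult: "laurent_fract (P * Q) = laurent_fract P * laurent_fract Q"
  by (simp add: laurent_fract_def)

lemma laurent_fract_add: "laurent_fract (P + Q) = laurent_fract P + laurent_fract Q"
  by (simp add: laurent_fract_def)

lemma laurent_fract_inj: "laurent_fract P = laurent_fract Q \<longleftrightarrow> P = Q"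
  by (simp add: laurent_fract_def eq_fract)

lemma laurent_fract_1: "laurent_fract 1 = 1"
  by (simp add: laurent_fract_def One_fract_def)

lemma laurent_fract_power: "laurent_fract (P ^ k) = laurent_fract P ^ k"
  by (induction k) (simp_all add: laurent_fract_1 laurent_fract_mult)

lemma laurent_fract_prod: "laurent_fract (prod P I) = (\<Prod>i\<in>I. laurent_fract (P i))"
  by (induction I rule: infinite_finite_induct) (simp_all add: laurent_fract_1 laurent_fract_mult)

lemma laurent_fract_nonzero: "P \<noteq> 0 \<Longrightarrow> laurent_fract P \<noteq> 0"
  using laurent_fract_inj[of P 0] by (simp add: laurent_fract_def Zero_fract_def)

text \<open>Nonvanishing is part of the notion so that the degree is unique; the notion is stable
  under products because Laurent polynomials have no zero divisors.\<close>

definition graded :: "nat \<Rightarrow> imat \<Rightarrow> ivec \<Rightarrow> laurent \<Rightarrow> bool" where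
  "graded n B0 g P \<longleftrightarrow> P \<noteq> 0 \<and> (\<forall>c\<in>Poly_Mapping.keys P. monomial_degree n B0 c = g)"

lemma monomial_degree_add: "monomial_degree n B0 (c + e) = monomial_degree n B0 c + monomial_degree n B0 e"
  by (simp add: monomial_degree_def lookup_add vscale_add_left sum.distrib)

lemma monomial_degree_zvecs: "monomial_degree n B0 c \<in> zvecs n"
  unfolding monomial_degree_def
  by (intro zvecs_add zvecs_sum zvecs_vscale zvecs_uminus zvecs_unit)
    (auto simp: zvecs_iff lookup_single when_def)

lemma monomial_degree_x:
  assumes "i \<in> {1..n}"
  shows "monomial_degree n B0 (unit_vec i) = unit_vec i"
proof -
  have "(\<Sum>j\<in>{1..n}. vscale (Poly_Mapping.lookup (unit_vec i) j) (unit_vec j)) = unit_vec i"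
    using zvecs_expand[OF zvecs_unit[OF assms]] by (rule sym)
  moreover have "(\<Sum>j\<in>{1..n}. vscale (Poly_Mapping.lookup (unit_vec i) (n + j))
      (- (\<Sum>l\<in>{1..n}. Poly_Mapping.single l (B0 l j)))) = 0"
    by (intro sum.neutral ballI) (use assms in \<open>auto simp: lookup_single when_def\<close>)
  ultimately show ?thesis
    unfolding monomial_degree_def by simp
qed

lemma monomial_degree_y:
  assumes "i \<in> {1..n}"
  shows "monomial_degree n B0 (unit_vec (n + i)) = - (\<Sum>l\<in>{1..n}. Poly_Mapping.single l (B0 l i))"
proof -
  have "(\<Sum>j\<in>{1..n}. vscale (Poly_Mapping.lookup (unit_vec (n + i)) j) (unit_vec j)) = 0"
    by (intro sum.neutral ballI) (use assms in \<open>auto simp: lookup_single when_def\<close>)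
  moreover have "(\<Sum>j\<in>{1..n}. vscale (Poly_Mapping.lookup (unit_vec (n + i)) (n + j))
      (- (\<Sum>l\<in>{1..n}. Poly_Mapping.single l (B0 l j)))) =
    (\<Sum>j\<in>{1..n}. if j = i then - (\<Sum>l\<in>{1..n}. Poly_Mapping.single l (B0 l i)) else 0)"
    by (intro sum.cong refl) (auto simp: lookup_single when_def)
  ultimately show ?thesis
    using assms unfolding monomial_degree_def by simp
qed

lemma graded_mult:
  assumes "graded n B0 g P" "graded n B0 h Q"
  shows "graded n B0 (g + h) (P * Q)"
  using assms subsetD[OF keys_mult[of P Q]]
  by (fastforce simp: graded_def monomial_degree_add)

lemma graded_1: "graded n B0 0 1"
  by (simp add: graded_def monomial_degree_def)

lemma graded_power: "graded n B0 g P \<Longrightarrow> graded n B0 (vscale (int k) g) (P ^ k)"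
  by (induction k) (auto simp: graded_1 vscale_add_left intro: graded_mult)

lemma graded_prod:
  "finite I \<Longrightarrow> (\<And>i. i \<in> I \<Longrightarrow> graded n B0 (g i) (P i)) \<Longrightarrow> graded n B0 (sum g I) (prod P I)"
  by (induction I rule: finite_induct) (auto simp: graded_1 intro: graded_mult)

lemma graded_unique:
  assumes "graded n B0 g P" "graded n B0 h P"
  shows "g = h"
  using assms unfolding graded_def by (metis all_not_in_conv keys_eq_empty)

text \<open>If the two degrees differed, the supports would be disjoint, nothing could cancel, and
  both degrees would occur in the homogeneous sum. Once they agree, any monomial of the sum shows
  that they equal its degree.\<close>

lemma graded_add_degrees:
  assumes P: "graded n B0 g P" and Q: "graded n B0 h Q" and PQ: "graded n B0 k (P + Q)"
  shows "g = k \<and> h = k"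
proof -
  have eq: "g = h" if "g \<noteq> k \<or> h \<noteq> k"
  proof (rule ccontr)
    assume "g \<noteq> h"
    obtain c e where c: "c \<in> Poly_Mapping.keys P" and e: "e \<in> Poly_Mapping.keys Q"
      using P Q unfolding graded_def by (metis all_not_in_conv keys_eq_empty)
    have "c \<notin> Poly_Mapping.keys Q" "e \<notin> Poly_Mapping.keys P"
      using c e P Q \<open>g \<noteq> h\<close> by (auto simp: graded_def)
    then have "c \<in> Poly_Mapping.keys (P + Q)" "e \<in> Poly_Mapping.keys (P + Q)"
      using c e by (auto simp: in_keys_iff lookup_add)
    then show False
      using c e P Q PQ that by (auto simp: graded_def)
  qed
  obtain c where c: "c \<in> Poly_Mapping.keys (P + Q)"
    using PQ unfolding graded_def by (metis all_not_in_conv keys_eq_empty)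
  then have "k = g \<or> k = h"
    using P Q PQ subsetD[OF keys_add c] by (auto simp: graded_def)
  then show ?thesis using eq by auto
qed

lemma homogeneous_of_degreeD:
  assumes "homogeneous_of_degree n B0 g z"
  obtains P where "z = laurent_fract P" "graded n B0 g P"
  using assms unfolding homogeneous_of_degree_def graded_def by blast

locale g_vector_pattern =
  fixes n :: nat and B0 :: imat and t0 :: "nat list" and x :: "nat list \<Rightarrow> nat \<Rightarrow> laurent fract"
    and b :: "nat list \<Rightarrow> imat" and g :: "nat list \<Rightarrow> nat \<Rightarrow> ivec"
  assumes t0: "t0 \<in> tree_vertices n"
    and pattern: "classical_principal_pattern n B0 t0 x b"
    and degrees: "t \<in> tree_vertices n \<Longrightarrow> j \<in> {1..n} \<Longrightarrow> homogeneous_of_degree n B0 (g t j) (x t j)"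
begin

lemma mutation: "tree_edge n k t t' \<Longrightarrow> matrix_mutation (2*n) n k (b t) (b t')"
  using pattern by (auto simp: classical_principal_pattern_def)

lemma initial_matrix: "is_principal_matrix n B0 (b t0)"
  using pattern by (auto simp: classical_principal_pattern_def)

lemma x_mutate_other: "tree_edge n k t t' \<Longrightarrow> i \<in> {1..2*n} \<Longrightarrow> i \<noteq> k \<Longrightarrow> x t' i = x t i"
  using pattern unfolding classical_principal_pattern_def by blast

lemma exchange_relation:
  "tree_edge n k t t' \<Longrightarrow> x t' k = inverse (x t k) *
     ((\<Prod>i\<in>{1..2*n}. x t i powi pos_part (b t i k)) + (\<Prod>i\<in>{1..2*n}. x t i powi pos_part (- b t i k)))"
  using pattern unfolding classical_principal_pattern_def by blast

lemma x_initial: "i \<in> {1..2*n} \<Longrightarrow> x t0 i = laurent_fract (Poly_Mapping.single (unit_vec i) 1)"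
  using pattern by (auto simp: classical_principal_pattern_def)

lemma x_frozen:
  assumes "t \<in> tree_vertices n" "i \<in> {n+1..2*n}"
  shows "x t i = laurent_fract (Poly_Mapping.single (unit_vec i) 1)"
  using t0 assms(1)
proof (rule tree_induct[where P = "\<lambda>t. x t i = laurent_fract (Poly_Mapping.single (unit_vec i) 1)"])
  fix k t t' assume e: "tree_edge n k t t'" and "x t i = laurent_fract (Poly_Mapping.single (unit_vec i) 1)"
  then show "x t' i = laurent_fract (Poly_Mapping.single (unit_vec i) 1)"
    using x_mutate_other[OF e, of i] tree_edge_vertices[OF e] assms(2) by auto
qed (use x_initial assms(2) in auto)

lemma g_unique:
  assumes "t \<in> tree_vertices n" "j \<in> {1..n}" "x t j = laurent_fract P" "graded n B0 h P"
  shows "g t j = h"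
proof -
  obtain Q where Q: "x t j = laurent_fract Q" "graded n B0 (g t j) Q"
    using degrees[OF assms(1,2)] by (elim homogeneous_of_degreeD)
  with assms show ?thesis using graded_unique laurent_fract_inj by metis
qed

lemma g_zvecs:
  assumes "t \<in> tree_vertices n" "j \<in> {1..n}"
  shows "g t j \<in> zvecs n"
proof -
  obtain Q where Q: "graded n B0 (g t j) Q"
    using degrees[OF assms] by (elim homogeneous_of_degreeD)
  then obtain c where "c \<in> Poly_Mapping.keys Q"
    unfolding graded_def by (metis all_not_in_conv keys_eq_empty)
  then have "g t j = monomial_degree n B0 c" using Q by (auto simp: graded_def)
  then show ?thesis using monomial_degree_zvecs by simp
qed

lemma g_initial:
  assumes "j \<in> {1..n}"
  shows "g t0 j = unit_vec j"
  by (rule g_unique[OF t0 assms x_initial]) (use assms in \<open>auto simp: graded_def monomial_degree_x[OF assms]\<close>)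

lemma g_mutate_other:
  assumes e: "tree_edge n k t t'" and j: "j \<in> {1..n}" "j \<noteq> k"
  shows "g t' j = g t j"
proof -
  have t: "t \<in> tree_vertices n" "t' \<in> tree_vertices n"
    using tree_edge_vertices[OF e] by auto
  obtain Q where Q: "x t j = laurent_fract Q" "graded n B0 (g t j) Q"
    using degrees[OF t(1) j(1)] by (elim homogeneous_of_degreeD)
  have "x t' j = laurent_fract Q"
    using x_mutate_other[OF e, of j] j Q(1) by simp
  then show ?thesis using g_unique[OF t(2) j(1)] Q(2) by simp
qed

text \<open>Clearing the denominator writes the product of the old and the new variable as a sum of
  two homogeneous terms. The product is homogeneous, so each term has its degree, which yields the
  formula for either sign.\<close>

lemma g_mutate:
  assumes e: "tree_edge n k t t'" and \<epsilon>: "\<epsilon> = 1 \<or> \<epsilon> = -1"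
  shows "g t k + g t' k = (\<Sum>i\<in>{1..n}. vscale (pos_part (\<epsilon> * b t i k)) (g t i))
    - (\<Sum>i\<in>{1..n}. vscale (pos_part (\<epsilon> * b t (n + i) k)) (\<Sum>l\<in>{1..n}. Poly_Mapping.single l (B0 l i)))"
proof -
  have t: "t \<in> tree_vertices n" "t' \<in> tree_vertices n" and k: "k \<in> {1..n}"
    using tree_edge_vertices[OF e] by auto
  define h where "h i = (if i \<le> n then g t i else - (\<Sum>l\<in>{1..n}. Poly_Mapping.single l (B0 l (i - n))))" for i
  have "\<exists>P. x t i = laurent_fract P \<and> graded n B0 (h i) P" if i: "i \<in> {1..2*n}" for i
  proof (cases "i \<le> n")
    case True
    then show ?thesis
      using degrees[OF t(1), of i] i by (auto simp: h_def elim!: homogeneous_of_degreeD)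
  next
    case False
    then have "i - n \<in> {1..n}" using i by auto
    then have "monomial_degree n B0 (unit_vec i) = h i"
      using monomial_degree_y[of "i - n" n B0] False by (simp add: h_def)
    then show ?thesis
      using x_frozen[OF t(1), of i] False i
      by (intro exI[of _ "Poly_Mapping.single (unit_vec i) 1"]) (auto simp: graded_def)
  qed
  then obtain P where P: "x t i = laurent_fract (P i)" "graded n B0 (h i) (P i)" if "i \<in> {1..2*n}" for i
    by metis
  obtain P' where P': "x t' k = laurent_fract P'" "graded n B0 (g t' k) P'"
    using degrees[OF t(2) k] by (elim homogeneous_of_degreeD)
  define R where "R \<delta> = (\<Prod>i\<in>{1..2*n}. P i ^ nat (pos_part (\<delta> * b t i k)))" for \<delta>
  have R: "graded n B0 (\<Sum>i\<in>{1..2*n}. vscale (pos_part (\<delta> * b t i k)) (h i)) (R \<delta>)" for \<delta>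
    unfolding R_def
  proof (rule graded_prod)
    show "graded n B0 (vscale (pos_part (\<delta> * b t i k)) (h i)) (P i ^ nat (pos_part (\<delta> * b t i k)))"
      if "i \<in> {1..2*n}" for i
      using graded_power[OF P(2)[OF that], of "nat (pos_part (\<delta> * b t i k))"] by (simp add: pos_part_def)
  qed simp
  have xR: "laurent_fract (R \<delta>) = (\<Prod>i\<in>{1..2*n}. x t i powi pos_part (\<delta> * b t i k))" for \<delta>
    unfolding R_def laurent_fract_prod
    by (intro prod.cong refl) (simp add: P(1) laurent_fract_power power_int_def pos_part_def)
  have k2: "k \<in> {1..2*n}" using k by auto
  have "x t k * x t' k = laurent_fract (R 1 + R (-1))"
    using exchange_relation[OF e] laurent_fract_nonzero[of "P k"] P[OF k2]
    by (simp add: laurent_fract_add xR graded_def)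
  then have "P k * P' = R 1 + R (-1)"
    by (simp add: P(1)[OF k2] P'(1) laurent_fract_mult[symmetric] laurent_fract_inj)
  moreover have "graded n B0 (h k + g t' k) (P k * P')"
    using graded_mult[OF P(2)[OF k2] P'(2)] .
  ultimately have "(\<Sum>i\<in>{1..2*n}. vscale (pos_part (\<epsilon> * b t i k)) (h i)) = h k + g t' k"
    using graded_add_degrees[OF R R, of "h k + g t' k" 1 "-1"] \<epsilon> by auto
  moreover have "h k = g t k" using k by (simp add: h_def)
  moreover have "(\<Sum>i\<in>{1..2*n}. vscale (pos_part (\<epsilon> * b t i k)) (h i)) =
      (\<Sum>i\<in>{1..n}. vscale (pos_part (\<epsilon> * b t i k)) (h i))
      + (\<Sum>i\<in>{1..n}. vscale (pos_part (\<epsilon> * b t (n + i) k)) (h (n + i)))"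
    by (rule sum_atLeastAtMost_double)
  moreover have "(\<Sum>i\<in>{1..n}. vscale (pos_part (\<epsilon> * b t i k)) (h i)) =
      (\<Sum>i\<in>{1..n}. vscale (pos_part (\<epsilon> * b t i k)) (g t i))"
    by (intro sum.cong refl) (simp add: h_def)
  moreover have "(\<Sum>i\<in>{1..n}. vscale (pos_part (\<epsilon> * b t (n + i) k)) (h (n + i))) =
      - (\<Sum>i\<in>{1..n}. vscale (pos_part (\<epsilon> * b t (n + i) k)) (\<Sum>l\<in>{1..n}. Poly_Mapping.single l (B0 l i)))"
    unfolding sum_negf[symmetric]
    by (intro sum.cong refl poly_mapping_eqI) (simp add: h_def)
  ultimately show ?thesis by simp
qed

end

section \<open>Principal coefficients\<close>

locale principal_quantum_cluster =
  fixes n :: nat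
    and d :: "nat \<Rightarrow> int"
    and B0 \<Lambda> :: imat
    and t0 :: "nat list"
    and v :: "'f::division_ring"
    and \<Lambda>L :: "'l::ab_group_add \<Rightarrow> 'l \<Rightarrow> int"
    and X :: "'l \<Rightarrow> 'f"
    and M :: "nat list \<Rightarrow> ivec \<Rightarrow> 'f"
    and \<Lambda>M :: "nat list \<Rightarrow> ivec \<Rightarrow> ivec \<Rightarrow> int"
    and B :: "nat list \<Rightarrow> imat"
    and g :: "nat list \<Rightarrow> nat \<Rightarrow> ivec"
    and w :: "'k::division_ring"
    and Z :: "nat \<Rightarrow> 'k"
    and F :: "nat list \<Rightarrow> nat \<Rightarrow> 'k"
  assumes d_pos: "\<forall>i\<in>{1..n}. d i > 0"
    and B0_skew: "\<forall>i\<in>{1..n}. \<forall>j\<in>{1..n}. d i * B0 i j = - (d j * B0 j i)"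
    and t0: "t0 \<in> tree_vertices n"
    and pattern: "principal_quantum_pattern v \<Lambda>L X n d B0 \<Lambda> t0 M \<Lambda>M B"
    and g_vectors: "is_g_vectors n B0 t0 g"
    and R: "torus_skew_field n d B0 w Z"
    and F_polynomials: "is_quantum_F_polynomials n d B0 t0 w Z v M B g F"
begin

lemma pattern_simps:
  shows ambient: "ambient_skew_field v \<Lambda>L X"
    and seed: "t \<in> tree_vertices n \<Longrightarrow> quantum_seed v \<Lambda>L X (2*n) n d (M t) (\<Lambda>M t) (B t)"
    and mutation: "tree_edge n k t t' \<Longrightarrow> quantum_mutation (2*n) n k (M t) (B t) (M t') (B t')"
    and initial_matrix: "is_principal_matrix n B0 (B t0)"
  using pattern unfolding principal_quantum_pattern_def quantum_cluster_pattern_def by blast+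

lemma frame: "t \<in> tree_vertices n \<Longrightarrow> quantum_frame v (2*n) (M t) (\<Lambda>M t)"
  using toric_frame_is_quantum_frame[OF ambient] seed unfolding quantum_seed_def by blast

definition column :: "nat list \<Rightarrow> nat \<Rightarrow> ivec" where
  "column t j = (\<Sum>i\<in>{1..2*n}. vscale (B t i j) (unit_vec i))"

lemma column_zvecs: "column t j \<in> zvecs (2*n)"
  unfolding column_def by (intro zvecs_sum zvecs_vscale zvecs_unit)

lemma lookup_column: "i \<in> {1..2*n} \<Longrightarrow> Poly_Mapping.lookup (column t j) i = B t i j"
  unfolding column_def by (subst lookup_sum_unit) auto

text \<open>The compatibility condition, extended linearly from unit vectors to all exponents. It is
  the source of the weights \<open>d j\<close> in L[a] and in \<lambda>.\<close>

lemma form_column: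
  assumes t: "t \<in> tree_vertices n" and j: "j \<in> {1..n}" and c: "c \<in> zvecs (2*n)"
  shows "\<Lambda>M t (column t j) c = d j * Poly_Mapping.lookup c j"
proof -
  interpret quantum_frame v "2*n" "M t" "\<Lambda>M t" using frame[OF t] .
  have compat: "(\<Sum>l\<in>{1..2*n}. B t l j * \<Lambda>M t (unit_vec l) (unit_vec i)) = (if i = j then d j else 0)"
    if "i \<in> {1..2*n}" for i
    using seed[OF t] that j unfolding quantum_seed_def compatible_pair_def by blast
  have "\<Lambda>M t (column t j) (unit_vec i) = (if i = j then d j else 0)" if "i \<in> {1..2*n}" for i
    unfolding column_def compat[OF that, symmetric] using that
    by (subst form_sum) (auto intro!: sum.cong zvecs_vscale zvecs_unit form_vscale)
  then have "\<Lambda>M t (column t j) c = (\<Sum>i\<in>{1..2*n}. if i = j then d j * Poly_Mapping.lookup c j else 0)"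
    unfolding form_expand_right[OF column_zvecs c] by (intro sum.cong refl) auto
  then show ?thesis using j by simp
qed

text \<open>Column k pairs with itself to \<open>d k * B t k k\<close>, which is zero by skewness,
  and \<open>d k\<close> is positive. This justifies the value 1 of \<open>F_hat\<close> at index
  k.\<close>

lemma exchange_matrix_diagonal:
  assumes t: "t \<in> tree_vertices n" and k: "k \<in> {1..n}"
  shows "B t k k = 0"
proof -
  interpret quantum_frame v "2*n" "M t" "\<Lambda>M t" using frame[OF t] .
  have "d k * B t k k = 0"
    using form_column[OF t k column_zvecs, of t k] form_self[OF column_zvecs, of t k] lookup_column[of k t k] k
    by simp
  moreover have "d k > 0" using d_pos k by blast
  ultimately show ?thesis by simp
qed

abbreviation "M0 \<equiv> M t0"
abbreviation "\<Lambda>0 \<equiv> \<Lambda>M t0"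
abbreviation "Y \<equiv> Y_hat n M0 (B t0)"

sublocale init: quantum_frame v "2*n" M0 \<Lambda>0
  using frame[OF t0] .

lemma initial_column:
  assumes "j \<in> {1..n}"
  shows "column t0 j = (\<Sum>l\<in>{1..n}. Poly_Mapping.single l (B0 l j)) + unit_vec (n + j)"
proof -
  have "(\<Sum>i\<in>{1..n}. vscale (B t0 i j) (unit_vec i)) = (\<Sum>l\<in>{1..n}. Poly_Mapping.single l (B0 l j))"
    using assms initial_matrix unfolding is_principal_matrix_def
    by (intro sum.cong refl poly_mapping_eqI) (auto simp: lookup_single when_def)
  moreover have "(\<Sum>i\<in>{1..n}. vscale (B t0 (n + i) j) (unit_vec (n + i))) =
      (\<Sum>i\<in>{1..n}. if i = j then unit_vec (n + j) else 0)"
    using assms initial_matrix unfolding is_principal_matrix_def by (intro sum.cong refl) auto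
  ultimately show ?thesis
    using assms unfolding column_def sum_atLeastAtMost_double by simp
qed

definition Yvec :: "ivec \<Rightarrow> ivec" where
  "Yvec c = (\<Sum>l\<in>{1..n}. vscale (Poly_Mapping.lookup c l) (column t0 l))"

lemma Yvec_zvecs: "Yvec c \<in> zvecs (2*n)"
  unfolding Yvec_def by (intro zvecs_sum zvecs_vscale column_zvecs)

lemma form_Yvec:
  assumes "c \<in> zvecs (2*n)"
  shows "\<Lambda>0 (Yvec a) c = (\<Sum>l\<in>{1..n}. Poly_Mapping.lookup a l * Poly_Mapping.lookup c l * d l)"
  unfolding Yvec_def using assms
  by (subst init.form_sum)
    (auto intro!: sum.cong zvecs_vscale column_zvecs simp: init.form_vscale column_zvecs form_column[OF t0])

lemma form_column_column:
  assumes "i \<in> {1..n}" "j \<in> {1..n}"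
  shows "\<Lambda>0 (column t0 i) (column t0 j) = d i * B0 i j"
  using form_column[OF t0 assms(1) column_zvecs] lookup_column[of i] assms initial_matrix
  by (simp add: is_principal_matrix_def)

lemma Y_monomial: "torus_monomial n d B0 v Y c = M0 (Yvec c)"
  using init.torus_monomial_frame[of n "column t0" d B0 c]
  unfolding Yvec_def Y_hat_def[abs_def] column_def[symmetric] by (simp add: column_zvecs form_column_column)

sublocale tr: torus_transfer n d B0 w Z v Y
proof -
  interpret source: quantum_frame w n "torus_monomial n d B0 w Z" "torus_form n d B0"
    using torus_skew_field_frame[OF R B0_skew] .
  have lookup: "Poly_Mapping.lookup (Yvec c) (n + i) = Poly_Mapping.lookup c i" if "i \<in> {1..n}" for c i
  proof -
    have "Poly_Mapping.lookup (column t0 l) (n + i) = (if l = i then 1 else 0)" if "l \<in> {1..n}" for l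
      using lookup_column[of "n + i" t0 l] that \<open>i \<in> {1..n}\<close> initial_matrix
      by (auto simp: is_principal_matrix_def)
    then have "Poly_Mapping.lookup (Yvec c) (n + i) = (\<Sum>l\<in>{1..n}. if l = i then Poly_Mapping.lookup c i else 0)"
      unfolding Yvec_def lookup_sum by (intro sum.cong refl) auto
    then show ?thesis using that by simp
  qed
  have inj: "inj_on Yvec (zvecs n)"
  proof (rule inj_onI)
    fix c e assume "c \<in> zvecs n" "e \<in> zvecs n" "Yvec c = Yvec e"
    then show "c = e"
      using lookup by (intro poly_mapping_eqI) (metis zvecs_iff)
  qed
  have add: "Yvec (c + e) = Yvec c + Yvec e" for c e
    by (simp add: Yvec_def lookup_add vscale_add_left sum.distrib)
  \<comment> \<open>By compatibility \<open>Yvec c\<close> sees only the first n coordinates of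
    \<open>Yvec e\<close>, and these are the coordinates of \<open>B0\<close> applied to e.\<close>
  have form: "\<Lambda>0 (Yvec c) (Yvec e) = torus_form n d B0 c e" for c e
  proof -
    have "Poly_Mapping.lookup (Yvec e) l = (\<Sum>j\<in>{1..n}. B0 l j * Poly_Mapping.lookup e j)" if "l \<in> {1..n}" for l
      unfolding Yvec_def lookup_sum using that initial_matrix
      by (intro sum.cong refl) (simp add: lookup_column is_principal_matrix_def)
    then show ?thesis
      unfolding form_Yvec[OF Yvec_zvecs] torus_form_def
      by (intro sum.cong refl) (simp add: sum_distrib_left sum_distrib_right mult_ac)
  qed
  have "quantum_frame v n (\<lambda>c. M0 (Yvec c)) (\<lambda>c e. \<Lambda>0 (Yvec c) (Yvec e))"
    by (rule init.reindex[OF inj]) (auto simp: Yvec_zvecs add)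
  then have "quantum_frame v n (torus_monomial n d B0 v Y) (torus_form n d B0)"
    by (rule quantum_frame_cong) (simp_all add: Y_monomial form)
  then show "torus_transfer n d B0 w Z v Y"
    unfolding torus_transfer_def using source.quantum_frame_axioms by blast
qed

lemma M0_subst:
  assumes a: "a \<in> zvecs (2*n)" and f: "f \<in> tr.torus"
  shows "M0 a * tr.subst f = tr.subst (tr.L a f) * M0 a"
proof (rule tr.subst_torus_L[OF _ f])
  fix c :: ivec
  \<comment> \<open>The factor 2 comes from commuting two frame elements; the minus sign in the
    twist comes from exchanging the arguments of the form.\<close>
  have "2 * \<Lambda>0 a (Yvec c) = tr.twist a c"
    using init.form_skew[OF a Yvec_zvecs] form_Yvec[OF a] by (simp add: tr.twist_def mult_ac)
  then show "init.q_commute (tr.twist a c) (M0 a) (torus_monomial n d B0 v Y c)"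
    using init.M_commute[OF a Yvec_zvecs] by (simp add: init.q_commute_def Y_monomial)
qed

text \<open>Before the i-th copy of f stand i - 1 copies of \<open>M0 a\<close>. Moving them to the
  right turns that copy into L[(i-1)a] f, which is the origin of the product
  \<open>G_factor\<close>.\<close>

lemma subst_M0_power:
  assumes a: "a \<in> zvecs (2*n)" and f: "f \<in> tr.torus"
  shows "(tr.subst f * M0 a) ^ k =
    tr.subst (prod_list (map (\<lambda>i. tr.L (vscale (int i - 1) a) f) [1..<Suc k])) * M0 (vscale (int k) a)"
proof (induction k)
  case (Suc k)
  let ?G = "prod_list (map (\<lambda>i. tr.L (vscale (int i - 1) a) f) [1..<Suc k])"
  have L: "tr.L b f \<in> tr.torus" for b
    using tr.torus_L_closed(1)[OF f] .
  have G: "?G \<in> tr.torus"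
    by (rule tr.torus_prod_list) (rule L)
  have ka: "vscale (int k) a \<in> zvecs (2*n)"
    using a by (rule zvecs_vscale)
  have "(tr.subst f * M0 a) ^ Suc k = tr.subst ?G * (M0 (vscale (int k) a) * tr.subst f) * M0 a"
    by (simp only: power_Suc2 Suc.IH mult.assoc)
  also have "\<dots> = tr.subst ?G * tr.subst (tr.L (vscale (int k) a) f) * (M0 (vscale (int k) a) * M0 a)"
    by (simp only: M0_subst[OF ka f] mult.assoc)
  also have "M0 (vscale (int k) a) * M0 a = M0 (vscale (int (Suc k)) a)"
    by (simp only: init.M_vscale_nat[OF a] power_Suc2)
  also have "tr.subst ?G * tr.subst (tr.L (vscale (int k) a) f) =
      tr.subst (prod_list (map (\<lambda>i. tr.L (vscale (int i - 1) a) f) [1..<Suc (Suc k)]))"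
    using tr.torus_subst_mult(2)[OF G L] by simp
  finally show ?case .
qed (simp add: tr.torus_subst_1)

lemma F_torus: "t \<in> tree_vertices n \<Longrightarrow> j \<in> {1..n} \<Longrightarrow> F t j \<in> tr.torus"
  using F_polynomials tr.torus_polynomials_subset by (auto simp: is_quantum_F_polynomials_def)

lemma cluster_variable:
  "t \<in> tree_vertices n \<Longrightarrow> j \<in> {1..n} \<Longrightarrow> M t (unit_vec j) = tr.subst (F t j) * M0 (g t j)"
  using F_polynomials by (auto simp: is_quantum_F_polynomials_def)

lemma g_vector_patternE:
  obtains x b where "g_vector_pattern n B0 t0 x b g"
  using g_vectors t0 unfolding is_g_vectors_def g_vector_pattern_def by blast

lemma g_frozen: "t \<in> tree_vertices n \<Longrightarrow> j \<in> {1..n} \<Longrightarrow> g t (n + j) = unit_vec (n + j)"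
  using g_vectors by (auto simp: is_g_vectors_def)

lemma g_zvecs:
  assumes t: "t \<in> tree_vertices n" and j: "j \<in> {1..2*n}"
  shows "g t j \<in> zvecs (2*n)"
proof (cases "j \<le> n")
  case True
  obtain x b where "g_vector_pattern n B0 t0 x b g" using g_vector_patternE .
  then show ?thesis
    using g_vector_pattern.g_zvecs[of n B0 t0 x b g t j] t j True zvecs_mono[of "g t j" n "2*n"] by simp
next
  case False
  then have "j - n \<in> {1..n}" using j by auto
  then show ?thesis using g_frozen[OF t, of "j - n"] j False by (auto intro: zvecs_unit)
qed

lemma g_initial: "j \<in> {1..n} \<Longrightarrow> g t0 j = unit_vec j"
  using g_vector_patternE g_vector_pattern.g_initial by metis

lemma g_mutate_other: "tree_edge n k t t' \<Longrightarrow> j \<in> {1..n} \<Longrightarrow> j \<noteq> k \<Longrightarrow> g t' j = g t j"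
  using g_vector_patternE g_vector_pattern.g_mutate_other by metis

lemma g_mutate:
  assumes e: "tree_edge n k t t'" and \<epsilon>: "\<epsilon> = 1 \<or> \<epsilon> = -1"
  shows "g t k + g t' k = (\<Sum>i\<in>{1..n}. vscale (pos_part (\<epsilon> * B t i k)) (g t i))
    - (\<Sum>i\<in>{1..n}. vscale (pos_part (\<epsilon> * B t (n + i) k)) (\<Sum>l\<in>{1..n}. Poly_Mapping.single l (B0 l i)))"
proof -
  obtain x b where "g_vector_pattern n B0 t0 x b g" using g_vector_patternE .
  then interpret gp: g_vector_pattern n B0 t0 x b g .
  have t: "t \<in> tree_vertices n" and k: "k \<in> {1..n}"
    using tree_edge_vertices[OF e] by auto
  have "matrix_mutation (2*n) n k (B t) (B t')" if "tree_edge n k t t'" for k t t'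
    using mutation[OF that] by (simp add: quantum_mutation_def)
  from principal_pattern_unique[of t0 n t B0 b B, OF t0 t gp.initial_matrix gp.mutation initial_matrix this]
  have b: "b t i k = B t i k" if "i \<in> {1..2*n}" for i
    using that k by blast
  show ?thesis
    unfolding gp.g_mutate[OF e \<epsilon>] by (intro arg_cong2[of _ _ _ _ minus] sum.cong refl) (simp_all add: b)
qed

lemma frozen_variable:
  assumes "t \<in> tree_vertices n" "j \<in> {1..n}"
  shows "M t (unit_vec (n + j)) = M0 (unit_vec (n + j))"
  using t0 assms(1)
proof (rule tree_induct[where P = "\<lambda>t. M t (unit_vec (n + j)) = M0 (unit_vec (n + j))"])
  fix k t t' assume e: "tree_edge n k t t'" and IH: "M t (unit_vec (n + j)) = M0 (unit_vec (n + j))"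
  have "n + j \<in> {1..2*n}" "n + j \<noteq> k" using tree_edge_vertices[OF e] assms(2) by auto
  then have "M t' (unit_vec (n + j)) = M t (unit_vec (n + j))"
    using mutation[OF e] unfolding quantum_mutation_def by blast
  then show "M t' (unit_vec (n + j)) = M0 (unit_vec (n + j))" using IH by simp
qed simp

text \<open>Frozen variables are the same at every vertex, hence so are their commutation relations,
  and these determine the form.\<close>

lemma frozen_form:
  assumes t: "t \<in> tree_vertices n" and "i \<in> {1..n}" "j \<in> {1..n}"
  shows "\<Lambda>M t (unit_vec (n + i)) (unit_vec (n + j)) = \<Lambda>0 (unit_vec (n + i)) (unit_vec (n + j))"
proof -
  interpret quantum_frame v "2*n" "M t" "\<Lambda>M t" using frame[OF t] .
  have u: "unit_vec (n + i) \<in> zvecs (2*n)" "unit_vec (n + j) \<in> zvecs (2*n)"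
    using assms by (auto intro!: zvecs_unit)
  show ?thesis
    using u init.M_commute[OF u] unfolding frozen_variable[OF t assms(2), symmetric] frozen_variable[OF t assms(3), symmetric]
    by (rule form_eq_if_commute)
qed

text \<open>Generators and their mutual forms agree at both vertices, so the normalising scalars do
  too. The bound \<open>m\<close> is the induction parameter.\<close>

lemma frozen_monomial:
  assumes t: "t \<in> tree_vertices n" and "m \<le> n"
  shows "M t (\<Sum>i\<in>{1..m}. vscale (a i) (unit_vec (n + i))) = M0 (\<Sum>i\<in>{1..m}. vscale (a i) (unit_vec (n + i)))"
  using assms(2)
proof (induction m)
  case 0
  interpret quantum_frame v "2*n" "M t" "\<Lambda>M t" using frame[OF t] .
  show ?case by simp
next
  case (Suc m)
  interpret quantum_frame v "2*n" "M t" "\<Lambda>M t" using frame[OF t] .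
  define f where "f = (\<Sum>i\<in>{1..m}. vscale (a i) (unit_vec (n + i)))"
  let ?u = "unit_vec (n + Suc m)"
  have u: "?u \<in> zvecs (2*n)" and f: "f \<in> zvecs (2*n)"
    unfolding f_def using Suc.prems by (auto intro!: zvecs_unit zvecs_sum zvecs_vscale)
  have unit: "unit_vec (n + i) \<in> zvecs (2*n)" if "i \<in> {1..m}" for i
    using Suc.prems that by (auto intro!: zvecs_unit)
  have "\<Lambda>M t f ?u = (\<Sum>i\<in>{1..m}. a i * \<Lambda>M t (unit_vec (n + i)) ?u)"
    unfolding f_def using unit u by (subst form_sum) (auto simp: form_vscale intro!: zvecs_vscale sum.cong)
  also have "\<dots> = (\<Sum>i\<in>{1..m}. a i * \<Lambda>0 (unit_vec (n + i)) ?u)"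
  proof (intro sum.cong refl)
    fix i assume "i \<in> {1..m}"
    then have "\<Lambda>M t (unit_vec (n + i)) ?u = \<Lambda>0 (unit_vec (n + i)) ?u"
      using Suc.prems by (intro frozen_form[OF t]) auto
    then show "a i * \<Lambda>M t (unit_vec (n + i)) ?u = a i * \<Lambda>0 (unit_vec (n + i)) ?u" by simp
  qed
  also have "\<dots> = \<Lambda>0 f ?u"
    unfolding f_def using unit u by (subst init.form_sum) (auto simp: init.form_vscale intro!: zvecs_vscale sum.cong)
  finally have "\<Lambda>M t f ?u = \<Lambda>0 f ?u" .
  then have "M t (f + vscale (a (Suc m)) ?u) = M0 (f + vscale (a (Suc m)) ?u)"
    using f u Suc frozen_variable[OF t, of "Suc m"]
    by (simp add: M_add init.M_add zvecs_vscale form_vscale_right init.form_vscale_right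
        M_vscale init.M_vscale f_def[symmetric, simplified])
  then show ?case by (simp add: f_def)
qed

section \<open>The exchange relation in terms of F-polynomials\<close>

lemma subst_F_nonzero:
  assumes "t \<in> tree_vertices n" "j \<in> {1..n}"
  shows "tr.subst (F t j) \<noteq> 0"
proof -
  interpret quantum_frame v "2*n" "M t" "\<Lambda>M t" using frame[OF assms(1)] .
  have "unit_vec j \<in> zvecs (2*n)" using assms(2) by (auto intro: zvecs_unit)
  then have "M t (unit_vec j) \<noteq> 0" by (rule M_nonzero)
  then show ?thesis unfolding cluster_variable[OF assms] by auto
qed

lemma L_torus: "t \<in> tree_vertices n \<Longrightarrow> j \<in> {1..n} \<Longrightarrow> tr.L a (F t j) \<in> tr.torus"
  using tr.torus_L_closed(1) F_torus by blast

text \<open>Inverting F_k(Y) M0(g_k) puts M0(-g_k) on the left of the inverse of F_k(Y). The left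
  factor L[-g_k] F_k is what F_k becomes when M0(-g_k) crosses it, so the inverse cancels.\<close>

lemma subst_L_inverse:
  assumes t: "t \<in> tree_vertices n" and k: "k \<in> {1..n}"
  shows "tr.subst (tr.L (- g t k) (F t k)) * M t (- unit_vec k) = M0 (- g t k)"
proof -
  interpret quantum_frame v "2*n" "M t" "\<Lambda>M t" using frame[OF t] .
  let ?f = "tr.subst (F t k)"
  have u: "unit_vec k \<in> zvecs (2*n)" and gk: "g t k \<in> zvecs (2*n)"
    using k g_zvecs[OF t, of k] by (auto intro!: zvecs_unit)
  have "M t (- unit_vec k) = inverse (M t (unit_vec k))"
    using u by (rule M_uminus)
  also have "\<dots> = inverse (M0 (g t k)) * inverse ?f"
    unfolding cluster_variable[OF t k]
    by (rule nonzero_inverse_mult_distrib) (use subst_F_nonzero[OF t k] init.M_nonzero[OF gk] in auto)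
  also have "inverse (M0 (g t k)) = M0 (- g t k)"
    using init.M_uminus[OF gk] by simp
  finally have "tr.subst (tr.L (- g t k) (F t k)) * M t (- unit_vec k) =
      tr.subst (tr.L (- g t k) (F t k)) * M0 (- g t k) * inverse ?f"
    by (simp only: mult.assoc)
  also have "\<dots> = M0 (- g t k) * ?f * inverse ?f"
    unfolding M0_subst[OF zvecs_uminus[OF gk] F_torus[OF t k]] ..
  also have "\<dots> = M0 (- g t k)"
    using subst_F_nonzero[OF t k] by (simp add: mult.assoc)
  finally show ?thesis .
qed

text \<open>Otherwise \<open>subst_L_inverse\<close> would make a frame element vanish. This permits
  division in the skew-field of R.\<close>

lemma L_F_nonzero:
  assumes "t \<in> tree_vertices n" "k \<in> {1..n}"
  shows "tr.L (- g t k) (F t k) \<noteq> 0"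
proof
  assume "tr.L (- g t k) (F t k) = 0"
  moreover have "tr.subst 0 = 0"
    using tr.corresponds_0 tr.corresponds_iff by blast
  ultimately have "M0 (- g t k) = 0"
    using subst_L_inverse[OF assms] by simp
  moreover have "- g t k \<in> zvecs (2*n)"
    using g_zvecs[OF assms(1), of k] assms(2) by (intro zvecs_uminus) auto
  ultimately show False using init.M_nonzero by blast
qed

section \<open>Normal ordering of a single exchange monomial\<close>

abbreviation \<rho> :: "nat list \<Rightarrow> imat" where
  "\<rho> t \<equiv> rho_entry \<Lambda>M t0 g t"

abbreviation p :: "nat list \<Rightarrow> nat \<Rightarrow> int \<Rightarrow> nat \<Rightarrow> int" where
  "p t k \<epsilon> i \<equiv> pos_part (\<epsilon> * B t i k)"

abbreviation Fhat :: "nat list \<Rightarrow> nat \<Rightarrow> int \<Rightarrow> nat \<Rightarrow> 'k" where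
  "Fhat t k \<epsilon> \<equiv> F_hat tr.L (B t) (g t) (F t) k \<epsilon>"

definition exponent_prefix :: "nat list \<Rightarrow> nat \<Rightarrow> int \<Rightarrow> nat \<Rightarrow> ivec" where
  "exponent_prefix t k \<epsilon> j = - unit_vec k + (\<Sum>i\<in>{1..j}. vscale (p t k \<epsilon> i) (unit_vec i))"

definition degree_prefix :: "nat list \<Rightarrow> nat \<Rightarrow> int \<Rightarrow> nat \<Rightarrow> ivec" where
  "degree_prefix t k \<epsilon> j = - g t k + (\<Sum>i\<in>{1..j}. vscale (p t k \<epsilon> i) (g t i))"

text \<open>The power of \<open>v\<close> accumulated after the first j mutable variables; for
  \<open>j = n\<close> these are the terms of twice \<rho>^\<epsilon> with mutable indices only. In
  the double sum the bound \<open>j\<close> shadows the argument, which survives only as upper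
  limit.\<close>

definition prefix_twist :: "nat list \<Rightarrow> nat \<Rightarrow> int \<Rightarrow> nat \<Rightarrow> int" where
  "prefix_twist t k \<epsilon> j = - (\<Sum>i\<in>{1..j}. p t k \<epsilon> i * \<rho> t i k)
     + (\<Sum>j\<in>{1..j}. \<Sum>i\<in>{1..<j}. p t k \<epsilon> i * p t k \<epsilon> j * \<rho> t j i)"

lemma prefix_zvecs:
  assumes t: "t \<in> tree_vertices n" and k: "k \<in> {1..n}" and j: "j \<le> n"
  shows "exponent_prefix t k \<epsilon> j \<in> zvecs (2*n)" "degree_prefix t k \<epsilon> j \<in> zvecs (2*n)"
  unfolding exponent_prefix_def degree_prefix_def using k j
  by (intro zvecs_add zvecs_uminus zvecs_sum zvecs_vscale zvecs_unit g_zvecs[OF t]; simp)+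

lemma rho_prefix:
  assumes t: "t \<in> tree_vertices n" and k: "k \<in> {1..n}" and j: "j \<le> n" and i: "i \<in> {1..2*n}"
  shows "\<Lambda>0 (degree_prefix t k \<epsilon> j) (g t i) - \<Lambda>M t (exponent_prefix t k \<epsilon> j) (unit_vec i) =
    - \<rho> t i k + (\<Sum>l\<in>{1..j}. p t k \<epsilon> l * \<rho> t i l)"
proof -
  interpret quantum_frame v "2*n" "M t" "\<Lambda>M t" using frame[OF t] .
  have unit: "unit_vec l \<in> zvecs (2*n)" if "l \<in> {1..2*n}" for l
    using that by (rule zvecs_unit)
  have gz: "g t l \<in> zvecs (2*n)" if "l \<in> {1..2*n}" for l
    using g_zvecs[OF t that] .
  have l2: "l \<in> {1..2*n}" if "l \<in> {1..j}" for l using that j by auto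
  have k2: "k \<in> {1..2*n}" using k by auto
  have "\<Lambda>0 (degree_prefix t k \<epsilon> j) (g t i) = - \<Lambda>0 (g t k) (g t i) + (\<Sum>l\<in>{1..j}. p t k \<epsilon> l * \<Lambda>0 (g t l) (g t i))"
  proof -
    have "\<Lambda>0 (\<Sum>l\<in>{1..j}. vscale (p t k \<epsilon> l) (g t l)) (g t i) = (\<Sum>l\<in>{1..j}. p t k \<epsilon> l * \<Lambda>0 (g t l) (g t i))"
      by (rule init.form_combination(1)) (use gz l2 i in blast)+
    moreover have "(\<Sum>l\<in>{1..j}. vscale (p t k \<epsilon> l) (g t l)) \<in> zvecs (2*n)"
      by (intro zvecs_sum zvecs_vscale gz l2)
    ultimately show ?thesis
      unfolding degree_prefix_def
      by (simp only: init.form_add[OF zvecs_uminus[OF gz[OF k2]] _ gz[OF i]] init.form_uminus(1)[OF gz[OF k2] gz[OF i]])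
  qed
  moreover have "\<Lambda>M t (exponent_prefix t k \<epsilon> j) (unit_vec i) =
      - \<Lambda>M t (unit_vec k) (unit_vec i) + (\<Sum>l\<in>{1..j}. p t k \<epsilon> l * \<Lambda>M t (unit_vec l) (unit_vec i))"
  proof -
    have "\<Lambda>M t (\<Sum>l\<in>{1..j}. vscale (p t k \<epsilon> l) (unit_vec l)) (unit_vec i) =
        (\<Sum>l\<in>{1..j}. p t k \<epsilon> l * \<Lambda>M t (unit_vec l) (unit_vec i))"
      by (rule form_combination(1)) (use unit l2 i in blast)+
    moreover have "(\<Sum>l\<in>{1..j}. vscale (p t k \<epsilon> l) (unit_vec l)) \<in> zvecs (2*n)"
      by (intro zvecs_sum zvecs_vscale unit l2)
    ultimately show ?thesis
      unfolding exponent_prefix_def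
      by (simp only: form_add[OF zvecs_uminus[OF unit[OF k2]] _ unit[OF i]] form_uminus(1)[OF unit[OF k2] unit[OF i]])
  qed
  \<comment> \<open>Both forms are skew, so transposing the indices of \<rho> absorbs the
    sign.\<close>
  moreover have skew: "\<Lambda>0 (g t l) (g t i) = \<Lambda>M t (unit_vec l) (unit_vec i) + \<rho> t i l" if "l \<in> {1..2*n}" for l
    using init.form_skew[OF gz[OF that] gz[OF i]] form_skew[OF unit[OF that] unit[OF i]]
    by (simp add: rho_entry_def)
  moreover have "(\<Sum>l\<in>{1..j}. p t k \<epsilon> l * \<Lambda>0 (g t l) (g t i)) =
      (\<Sum>l\<in>{1..j}. p t k \<epsilon> l * \<Lambda>M t (unit_vec l) (unit_vec i)) + (\<Sum>l\<in>{1..j}. p t k \<epsilon> l * \<rho> t i l)"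
    unfolding sum.distrib[symmetric] by (intro sum.cong refl) (simp only: skew[OF l2] distrib_left)
  ultimately show ?thesis using skew[OF k2] by simp
qed

lemma Fhat_torus:
  assumes t: "t \<in> tree_vertices n" and j: "j \<in> {1..n}"
  shows "G_factor tr.L (B t) (g t) (F t) k \<epsilon> j \<in> tr.torus" "Fhat t k \<epsilon> j \<in> tr.torus"
proof -
  show G: "G_factor tr.L (B t) (g t) (F t) k \<epsilon> j \<in> tr.torus"
    unfolding G_factor_def by (rule tr.torus_prod_list) (rule L_torus[OF t j])
  show "Fhat t k \<epsilon> j \<in> tr.torus"
    using tr.torus_L_closed(1)[OF G] by (simp add: F_hat_def tr.torus_subst_1)
qed

text \<open>The new factor is a power of F(Y) M0(g), which \<open>subst_M0_power\<close> collects
  into \<open>G_factor\<close>. Moving the accumulated degree across it applies exactly the operator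
  in the definition of \<open>F_hat\<close>.\<close>

lemma Fhat_step:
  assumes t: "t \<in> tree_vertices n" and k: "k \<in> {1..n}" and j: "Suc j \<le> n"
  shows "M0 (degree_prefix t k \<epsilon> j) * M t (vscale (p t k \<epsilon> (Suc j)) (unit_vec (Suc j))) =
    tr.subst (Fhat t k \<epsilon> (Suc j)) * (M0 (degree_prefix t k \<epsilon> j) * M0 (vscale (p t k \<epsilon> (Suc j)) (g t (Suc j))))"
proof -
  interpret quantum_frame v "2*n" "M t" "\<Lambda>M t" using frame[OF t] .
  have J: "Suc j \<in> {1..n}" and u: "unit_vec (Suc j) \<in> zvecs (2*n)" and gz: "g t (Suc j) \<in> zvecs (2*n)"
    using j g_zvecs[OF t, of "Suc j"] by (auto intro!: zvecs_unit)
  show ?thesis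
  proof (cases "Suc j = k")
    \<comment> \<open>At index k the exponent is zero because the diagonal entry vanishes, so every
      factor involved is 1.\<close>
    case True
    then have "p t k \<epsilon> (Suc j) = 0"
      using exchange_matrix_diagonal[OF t k] by (simp add: pos_part_def)
    then show ?thesis using True by (simp add: F_hat_def tr.torus_subst_1)
  next
    case False
    let ?G = "G_factor tr.L (B t) (g t) (F t) k \<epsilon> (Suc j)"
    let ?q = "nat (p t k \<epsilon> (Suc j))"
    have q: "int ?q = p t k \<epsilon> (Suc j)" by (simp add: pos_part_def)
    have Fhat: "Fhat t k \<epsilon> (Suc j) = tr.L (degree_prefix t k \<epsilon> j) ?G"
      using False by (simp add: F_hat_def degree_prefix_def atLeastLessThanSuc_atLeastAtMost)
    have "M t (vscale (p t k \<epsilon> (Suc j)) (unit_vec (Suc j))) = (tr.subst (F t (Suc j)) * M0 (g t (Suc j))) ^ ?q"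
      using M_vscale_nat[OF u, of ?q] unfolding q cluster_variable[OF t J] .
    also have "\<dots> = tr.subst ?G * M0 (vscale (p t k \<epsilon> (Suc j)) (g t (Suc j)))"
      using subst_M0_power[OF gz F_torus[OF t J], of ?q] unfolding q G_factor_def .
    finally have "M0 (degree_prefix t k \<epsilon> j) * M t (vscale (p t k \<epsilon> (Suc j)) (unit_vec (Suc j))) =
        M0 (degree_prefix t k \<epsilon> j) * tr.subst ?G * M0 (vscale (p t k \<epsilon> (Suc j)) (g t (Suc j)))"
      by (simp only: mult.assoc)
    then show ?thesis
      using M0_subst[OF prefix_zvecs(2)[OF t k] Fhat_torus(1)[OF t J], of j \<epsilon> k \<epsilon>] j
      by (simp add: Fhat mult.assoc)
  qed
qed

text \<open>Induction on the number of variables split off, starting from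
  \<open>subst_L_inverse\<close>. Each step pays the form at t for splitting and gains the initial
  form for merging; \<open>rho_prefix\<close> evaluates the difference.\<close>

lemma prefix_product:
  assumes t: "t \<in> tree_vertices n" and k: "k \<in> {1..n}" and j: "j \<le> n"
  shows "tr.subst (tr.L (- g t k) (F t k)) * M t (exponent_prefix t k \<epsilon> j) =
    v powi prefix_twist t k \<epsilon> j * tr.subst (prod_list (map (Fhat t k \<epsilon>) [1..<Suc j])) * M0 (degree_prefix t k \<epsilon> j)"
  using j
proof (induction j)
  case 0
  show ?case
    using subst_L_inverse[OF t k]
    by (simp add: exponent_prefix_def degree_prefix_def prefix_twist_def tr.torus_subst_1)
next
  case (Suc j)
  interpret quantum_frame v "2*n" "M t" "\<Lambda>M t" using frame[OF t] .
  let ?J = "Suc j"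
  let ?p = "p t k \<epsilon> ?J"
  let ?A = "tr.subst (tr.L (- g t k) (F t k))"
  let ?S = "exponent_prefix t k \<epsilon> j" and ?H = "degree_prefix t k \<epsilon> j"
  let ?P = "prod_list (map (Fhat t k \<epsilon>) [1..<Suc j])"
  have J: "?J \<in> {1..n}" and J2: "?J \<in> {1..2*n}" and u: "unit_vec ?J \<in> zvecs (2*n)" and gz: "g t ?J \<in> zvecs (2*n)"
    using Suc.prems g_zvecs[OF t, of "Suc j"] by (auto intro!: zvecs_unit)
  have jn: "j \<le> n" using Suc.prems by simp
  note S = prefix_zvecs(1)[OF t k jn, of \<epsilon>] and H = prefix_zvecs(2)[OF t k jn, of \<epsilon>]
  have S_Suc: "exponent_prefix t k \<epsilon> ?J = ?S + vscale ?p (unit_vec ?J)"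
    and H_Suc: "degree_prefix t k \<epsilon> ?J = ?H + vscale ?p (g t ?J)"
    by (simp_all add: exponent_prefix_def degree_prefix_def add.assoc)
  have P: "?P \<in> tr.torus"
    using jn by (intro tr.torus_prod_list Fhat_torus(2)[OF t]) auto
  have "?A * M t (exponent_prefix t k \<epsilon> ?J) =
      v powi (- \<Lambda>M t ?S (vscale ?p (unit_vec ?J))) * (?A * M t ?S * M t (vscale ?p (unit_vec ?J)))"
    unfolding S_Suc M_add[OF S zvecs_vscale[OF u]] by (simp only: init.vpow_left_commute[of ?A] mult.assoc)
  also have "?A * M t ?S * M t (vscale ?p (unit_vec ?J)) = v powi prefix_twist t k \<epsilon> j * (tr.subst ?P *
      (M0 ?H * M t (vscale ?p (unit_vec ?J))))"
    by (simp only: Suc.IH[OF jn] mult.assoc)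
  also have "M0 ?H * M t (vscale ?p (unit_vec ?J)) =
      tr.subst (Fhat t k \<epsilon> ?J) * (v powi \<Lambda>0 ?H (vscale ?p (g t ?J)) * M0 (degree_prefix t k \<epsilon> ?J))"
    unfolding Fhat_step[OF t k Suc.prems] H_Suc init.M_mult[OF H zvecs_vscale[OF gz]] ..
  also have "v powi (- \<Lambda>M t ?S (vscale ?p (unit_vec ?J))) * (v powi prefix_twist t k \<epsilon> j * (tr.subst ?P *
      (tr.subst (Fhat t k \<epsilon> ?J) * (v powi \<Lambda>0 ?H (vscale ?p (g t ?J)) * M0 (degree_prefix t k \<epsilon> ?J))))) =
    v powi (- \<Lambda>M t ?S (vscale ?p (unit_vec ?J)) + prefix_twist t k \<epsilon> j + \<Lambda>0 ?H (vscale ?p (g t ?J))) *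
      (tr.subst ?P * tr.subst (Fhat t k \<epsilon> ?J)) * M0 (degree_prefix t k \<epsilon> ?J)"
    by (simp only: init.vpow_add init.vpow_left_commute[of "tr.subst ?P"] init.vpow_left_commute[of "tr.subst (Fhat t k \<epsilon> ?J)"] mult.assoc)
  also have "tr.subst ?P * tr.subst (Fhat t k \<epsilon> ?J) = tr.subst (prod_list (map (Fhat t k \<epsilon>) [1..<Suc ?J]))"
    using tr.torus_subst_mult(2)[OF P Fhat_torus(2)[OF t J]] by simp
  also have "- \<Lambda>M t ?S (vscale ?p (unit_vec ?J)) + prefix_twist t k \<epsilon> j + \<Lambda>0 ?H (vscale ?p (g t ?J)) =
      prefix_twist t k \<epsilon> ?J"
  proof -
    have "- \<Lambda>M t ?S (vscale ?p (unit_vec ?J)) + \<Lambda>0 ?H (vscale ?p (g t ?J)) =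
        ?p * (\<Lambda>0 ?H (g t ?J) - \<Lambda>M t ?S (unit_vec ?J))"
      by (simp add: form_vscale_right[OF S u] init.form_vscale_right[OF H gz] algebra_simps)
    also have "\<dots> = - (?p * \<rho> t ?J k) + (\<Sum>l\<in>{1..j}. p t k \<epsilon> l * ?p * \<rho> t ?J l)"
      unfolding rho_prefix[OF t k jn J2] by (simp add: right_diff_distrib sum_distrib_left mult_ac)
    finally show ?thesis
      by (simp add: prefix_twist_def atLeastLessThanSuc_atLeastAtMost)
  qed
  finally show ?case .
qed

definition frozen_part :: "nat list \<Rightarrow> nat \<Rightarrow> int \<Rightarrow> ivec" where
  "frozen_part t k \<epsilon> = (\<Sum>l\<in>{1..n}. vscale (p t k \<epsilon> (n + l)) (unit_vec (n + l)))"

definition Z_exponent :: "nat list \<Rightarrow> nat \<Rightarrow> int \<Rightarrow> ivec" where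
  "Z_exponent t k \<epsilon> = (\<Sum>l\<in>{1..n}. vscale (p t k \<epsilon> (n + l)) (unit_vec l))"

definition q_exponent :: "nat list \<Rightarrow> nat list \<Rightarrow> nat \<Rightarrow> int \<Rightarrow> int" where
  "q_exponent t t' k \<epsilon> = prefix_twist t k \<epsilon> n
     + (\<Sum>l\<in>{1..n}. p t k \<epsilon> (n + l) * (- \<rho> t (n + l) k + (\<Sum>i\<in>{1..n}. p t k \<epsilon> i * \<rho> t (n + l) i)))
     - (\<Sum>l\<in>{1..n}. p t k \<epsilon> (n + l) * Poly_Mapping.lookup (g t' k) l * d l)"

text \<open>Twice the rational exponent is an integer, so the floor is exact. What remains is
  splitting the sum over 2n indices and exchanging the order of the mixed double sum.\<close>

lemma q_power_exponent:
  "q_power w (rho_exponent n (B t) (\<rho> t) k \<epsilon> - lambda_exponent n d (B t) (g t' k) k \<epsilon>) = w powi q_exponent t t' k \<epsilon>"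
proof -
  let ?S2 = "\<Sum>i\<in>{1..n}. \<Sum>j\<in>{1..n}. p t k \<epsilon> i * p t k \<epsilon> (n + j) * \<rho> t (n + j) i"
  let ?S1 = "\<Sum>j\<in>{1..n}. \<Sum>i\<in>{1..<j}. p t k \<epsilon> i * p t k \<epsilon> j * \<rho> t j i"
  let ?S0 = "\<Sum>i\<in>{1..2*n}. p t k \<epsilon> i * \<rho> t i k"
  let ?lam = "\<Sum>l\<in>{1..n}. p t k \<epsilon> (n + l) * Poly_Mapping.lookup (g t' k) l * d l"
  have S2: "?S2 = (\<Sum>l\<in>{1..n}. p t k \<epsilon> (n + l) * (\<Sum>i\<in>{1..n}. p t k \<epsilon> i * \<rho> t (n + l) i))"
    unfolding sum_distrib_left by (subst sum.swap) (simp add: mult_ac)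
  have "q_exponent t t' k \<epsilon> = - ?S0 + ?S1 + ?S2 - ?lam"
    unfolding q_exponent_def prefix_twist_def S2 sum_atLeastAtMost_double[of "\<lambda>i. p t k \<epsilon> i * \<rho> t i k"]
    by (simp add: right_diff_distrib sum_subtractf)
  moreover have "2 * (rho_exponent n (B t) (\<rho> t) k \<epsilon> - lambda_exponent n d (B t) (g t' k) k \<epsilon>) =
      of_int (- ?S0 + ?S1 + ?S2 - ?lam)"
    unfolding rho_exponent_def lambda_exponent_def of_int_diff by (simp only: algebra_simps) simp
  ultimately show ?thesis
    unfolding q_power_def by (simp only: floor_of_int)
qed

lemma exchange_term:
  assumes e: "tree_edge n k t t'" and \<epsilon>: "\<epsilon> = 1 \<or> \<epsilon> = -1"
  shows "tr.subst (tr.L (- g t k) (F t k)) *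
      M t (- unit_vec k + (\<Sum>i\<in>{1..2*n}. vscale (p t k \<epsilon> i) (unit_vec i))) =
    v powi q_exponent t t' k \<epsilon> * tr.subst (prod_list (map (Fhat t k \<epsilon>) [1..<Suc n]))
      * tr.subst (torus_monomial n d B0 w Z (Z_exponent t k \<epsilon>)) * M0 (g t' k)"
proof -
  have t: "t \<in> tree_vertices n" "t' \<in> tree_vertices n" and k: "k \<in> {1..n}"
    using tree_edge_vertices[OF e] by auto
  interpret quantum_frame v "2*n" "M t" "\<Lambda>M t" using frame[OF t(1)] .
  let ?A = "tr.subst (tr.L (- g t k) (F t k))"
  let ?P = "tr.subst (prod_list (map (Fhat t k \<epsilon>) [1..<Suc n]))"
  let ?S = "exponent_prefix t k \<epsilon> n" and ?H = "degree_prefix t k \<epsilon> n"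
  let ?f = "frozen_part t k \<epsilon>" and ?c = "Z_exponent t k \<epsilon>"
  note S = prefix_zvecs(1)[OF t(1) k order.refl, of \<epsilon>] and H = prefix_zvecs(2)[OF t(1) k order.refl, of \<epsilon>]
  have unit: "unit_vec (n + l) \<in> zvecs (2*n)" if "l \<in> {1..n}" for l
    using that by (auto intro!: zvecs_unit)
  have f: "?f \<in> zvecs (2*n)"
    unfolding frozen_part_def using unit by (intro zvecs_sum zvecs_vscale)
  have g': "g t' k \<in> zvecs (2*n)" using g_zvecs[OF t(2)] k by auto
  have c: "?c \<in> zvecs n"
    unfolding Z_exponent_def by (intro zvecs_sum zvecs_vscale zvecs_unit)
  have lookup_c: "Poly_Mapping.lookup ?c l = p t k \<epsilon> (n + l)" if "l \<in> {1..n}" for l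
    unfolding Z_exponent_def using that by (subst lookup_sum_unit) auto
  have vec: "- unit_vec k + (\<Sum>i\<in>{1..2*n}. vscale (p t k \<epsilon> i) (unit_vec i)) = ?S + ?f"
    unfolding sum_atLeastAtMost_double exponent_prefix_def frozen_part_def by (simp only: add.assoc)
  have "Yvec ?c = (\<Sum>l\<in>{1..n}. vscale (p t k \<epsilon> (n + l)) ((\<Sum>i\<in>{1..n}. Poly_Mapping.single i (B0 i l)) + unit_vec (n + l)))"
    unfolding Yvec_def by (intro sum.cong refl) (simp only: lookup_c initial_column)
  also have "\<dots> = (\<Sum>l\<in>{1..n}. vscale (p t k \<epsilon> (n + l)) (\<Sum>i\<in>{1..n}. Poly_Mapping.single i (B0 i l))) + ?f"
    unfolding frozen_part_def vscale_add_right sum.distrib ..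
  finally have deg: "?H + ?f = Yvec ?c + g t' k"
    using g_mutate[OF e \<epsilon>] unfolding degree_prefix_def by (simp add: algebra_simps)
  have Mf: "M t ?f = M0 ?f"
    unfolding frozen_part_def by (rule frozen_monomial[OF t(1) order.refl])
  have "\<Lambda>0 (Yvec ?c) (g t' k) = (\<Sum>l\<in>{1..n}. p t k \<epsilon> (n + l) * Poly_Mapping.lookup (g t' k) l * d l)"
    unfolding form_Yvec[OF g'] by (intro sum.cong refl) (simp only: lookup_c)
  moreover have "\<Lambda>0 ?H ?f - \<Lambda>M t ?S ?f =
      (\<Sum>l\<in>{1..n}. p t k \<epsilon> (n + l) * (\<Lambda>0 ?H (unit_vec (n + l)) - \<Lambda>M t ?S (unit_vec (n + l))))"
  proof -
    have "\<Lambda>M t ?S ?f = (\<Sum>l\<in>{1..n}. p t k \<epsilon> (n + l) * \<Lambda>M t ?S (unit_vec (n + l)))"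
      unfolding frozen_part_def by (rule form_combination(2)) (use unit S in blast)+
    moreover have "\<Lambda>0 ?H ?f = (\<Sum>l\<in>{1..n}. p t k \<epsilon> (n + l) * \<Lambda>0 ?H (unit_vec (n + l)))"
      unfolding frozen_part_def by (rule init.form_combination(2)) (use unit H in blast)+
    ultimately show ?thesis by (simp only: right_diff_distrib sum_subtractf)
  qed
  moreover have "\<dots> = (\<Sum>l\<in>{1..n}. p t k \<epsilon> (n + l) * (- \<rho> t (n + l) k + (\<Sum>i\<in>{1..n}. p t k \<epsilon> i * \<rho> t (n + l) i)))"
  proof (intro sum.cong refl)
    fix l assume l: "l \<in> {1..n}"
    then have "n + l \<in> {1..2*n}" by auto
    from rho_prefix[OF t(1) k order.refl this, of \<epsilon>]
    show "p t k \<epsilon> (n + l) * (\<Lambda>0 ?H (unit_vec (n + l)) - \<Lambda>M t ?S (unit_vec (n + l))) =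
        p t k \<epsilon> (n + l) * (- \<rho> t (n + l) k + (\<Sum>i\<in>{1..n}. p t k \<epsilon> i * \<rho> t (n + l) i))"
      unfolding g_frozen[OF t(1) l] by simp
  qed
  ultimately have exponent: "- \<Lambda>M t ?S ?f + prefix_twist t k \<epsilon> n + \<Lambda>0 ?H ?f + (- \<Lambda>0 (Yvec ?c) (g t' k)) =
      q_exponent t t' k \<epsilon>"
    unfolding q_exponent_def by linarith
  have "?A * M t (?S + ?f) = v powi (- \<Lambda>M t ?S ?f) * (?A * M t ?S * M0 ?f)"
    unfolding M_add[OF S f] Mf by (simp only: init.vpow_left_commute[of ?A] mult.assoc)
  also have "?A * M t ?S * M0 ?f = v powi prefix_twist t k \<epsilon> n * (?P * (M0 ?H * M0 ?f))"
    by (simp only: prefix_product[OF t(1) k order.refl] mult.assoc)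
  also have "M0 ?H * M0 ?f = v powi \<Lambda>0 ?H ?f * (v powi (- \<Lambda>0 (Yvec ?c) (g t' k)) * (M0 (Yvec ?c) * M0 (g t' k)))"
    unfolding init.M_mult[OF H f] deg init.M_add[OF Yvec_zvecs g'] ..
  also have "M0 (Yvec ?c) = tr.subst (torus_monomial n d B0 w Z ?c)"
    unfolding tr.torus_subst_ZM(2)[OF c] Y_monomial ..
  finally show ?thesis
    unfolding vec exponent[symmetric] init.vpow_add by (simp only: init.vpow_left_commute[of ?P] mult.assoc)
qed

lemma F_recurrence:
  assumes e: "tree_edge n k t t'"
  shows "F t' k =
    w powi q_exponent t t' k 1 * F_hat_inv tr.L (g t) (F t) k
      * prod_list (map (Fhat t k 1) [1..<Suc n]) * torus_monomial n d B0 w Z (Z_exponent t k 1)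
    + w powi q_exponent t t' k (-1) * F_hat_inv tr.L (g t) (F t) k
      * prod_list (map (Fhat t k (-1)) [1..<Suc n]) * torus_monomial n d B0 w Z (Z_exponent t k (-1))"
proof -
  have t: "t \<in> tree_vertices n" "t' \<in> tree_vertices n" and k: "k \<in> {1..n}"
    using tree_edge_vertices[OF e] by auto
  define A where "A = tr.L (- g t k) (F t k)"
  define P where "P \<epsilon> = prod_list (map (Fhat t k \<epsilon>) [1..<Suc n])" for \<epsilon>
  define T where "T \<epsilon> = torus_monomial n d B0 w Z (Z_exponent t k \<epsilon>)" for \<epsilon>
  define q where "q \<epsilon> = q_exponent t t' k \<epsilon>" for \<epsilon>
  have A: "A \<in> tr.torus"
    unfolding A_def by (rule L_torus[OF t(1) k])
  have P: "P \<epsilon> \<in> tr.torus" for \<epsilon>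
    unfolding P_def using Fhat_torus(2)[OF t(1)] by (intro tr.torus_prod_list) auto
  have T: "T \<epsilon> \<in> tr.torus" for \<epsilon>
    unfolding T_def Z_exponent_def by (intro tr.torus_subst_ZM zvecs_sum zvecs_vscale zvecs_unit)
  have F: "F t' k \<in> tr.torus" using F_torus[OF t(2) k] .
  have g': "M0 (g t' k) \<noteq> 0"
    using g_zvecs[OF t(2)] k by (intro init.M_nonzero) auto
  have summand: "tr.subst A * M t (- unit_vec k + (\<Sum>i\<in>{1..2*n}. vscale (pos_part (\<epsilon> * B t i k)) (unit_vec i))) =
      tr.subst (w powi q \<epsilon> * P \<epsilon> * T \<epsilon>) * M0 (g t' k)" if "\<epsilon> = 1 \<or> \<epsilon> = -1" for \<epsilon>
  proof -
    have "tr.subst (w powi q \<epsilon> * P \<epsilon> * T \<epsilon>) = v powi q \<epsilon> * tr.subst (P \<epsilon>) * tr.subst (T \<epsilon>)"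
      by (simp add: P T tr.torus_subst_vpow tr.torus_subst_mult)
    then show ?thesis
      unfolding A_def P_def T_def q_def using exchange_term[OF e that] by (simp only:)
  qed
  have "M t' (unit_vec k) =
      M t (- unit_vec k + (\<Sum>i\<in>{1..2*n}. vscale (pos_part (1 * B t i k)) (unit_vec i)))
    + M t (- unit_vec k + (\<Sum>i\<in>{1..2*n}. vscale (pos_part ((-1) * B t i k)) (unit_vec i)))"
    using mutation[OF e] by (simp add: quantum_mutation_def)
  then have "tr.subst A * M t' (unit_vec k) =
      (tr.subst (w powi q 1 * P 1 * T 1) + tr.subst (w powi q (-1) * P (-1) * T (-1))) * M0 (g t' k)"
    unfolding distrib_right using summand[of 1] summand[of "-1"] by (simp only: distrib_left) simp
  then have "tr.subst A * tr.subst (F t' k) =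
      tr.subst (w powi q 1 * P 1 * T 1) + tr.subst (w powi q (-1) * P (-1) * T (-1))"
    unfolding cluster_variable[OF t(2) k] mult.assoc[symmetric] using g' by simp
  \<comment> \<open>After cancelling \<open>M0 (g t' k)\<close> on the right, both sides are
    substitutions of elements of R, so injectivity applies; division by \<open>A\<close> happens
    only afterwards.\<close>
  then have "tr.subst (A * F t' k) = tr.subst (w powi q 1 * P 1 * T 1 + w powi q (-1) * P (-1) * T (-1))"
    using A F P T tr.torus_subst_vpow by (simp add: tr.torus_subst_mult tr.torus_subst_add)
  then have "A * F t' k = w powi q 1 * P 1 * T 1 + w powi q (-1) * P (-1) * T (-1)"
    using A F P T tr.torus_subst_vpow
    by (intro tr.subst_inj) (simp_all add: tr.torus_subst_mult tr.torus_subst_add)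
  moreover have "A \<noteq> 0"
    unfolding A_def by (rule L_F_nonzero[OF t(1) k])
  ultimately have "F t' k = inverse A * (w powi q 1 * P 1 * T 1 + w powi q (-1) * P (-1) * T (-1))"
    by (metis left_inverse mult.assoc mult_1_left)
  also have "\<dots> = w powi q 1 * inverse A * P 1 * T 1 + w powi q (-1) * inverse A * P (-1) * T (-1)"
    by (simp only: distrib_left mult.assoc tr.source.vpow_left_commute[of "inverse A"])
  finally show ?thesis
    unfolding A_def P_def T_def q_def F_hat_inv_def .
qed

section \<open>Initial values and polynomials unchanged by a mutation\<close>

lemma F_initial:
  assumes j: "j \<in> {1..n}"
  shows "F t0 j = 1"
proof -
  have "unit_vec j \<in> zvecs (2*n)" using j by (auto intro!: zvecs_unit)
  then have "M0 (unit_vec j) \<noteq> 0" by (rule init.M_nonzero)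
  moreover have "tr.subst (F t0 j) * M0 (unit_vec j) = tr.subst 1 * M0 (unit_vec j)"
    using cluster_variable[OF t0 j, symmetric] unfolding g_initial[OF j] tr.torus_subst_1(2) by simp
  ultimately have "tr.subst (F t0 j) = tr.subst 1" by simp
  then show ?thesis
    using tr.subst_inj F_torus[OF t0 j] tr.torus_subst_1(1) by blast
qed

lemma F_mutate_other:
  assumes e: "tree_edge n k t t'" and j: "j \<in> {1..n}" "j \<noteq> k"
  shows "F t' j = F t j"
proof -
  have t: "t \<in> tree_vertices n" "t' \<in> tree_vertices n"
    using tree_edge_vertices[OF e] by auto
  have "j \<in> {1..2*n}" using j by auto
  then have "M t' (unit_vec j) = M t (unit_vec j)"
    using mutation[OF e] j unfolding quantum_mutation_def by blast
  then have "tr.subst (F t' j) * M0 (g t j) = tr.subst (F t j) * M0 (g t j)"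
    unfolding cluster_variable[OF t(1) j(1)] cluster_variable[OF t(2) j(1)] g_mutate_other[OF e j] .
  moreover have "M0 (g t j) \<noteq> 0"
    using g_zvecs[OF t(1), of j] j by (intro init.M_nonzero) auto
  ultimately show ?thesis
    using tr.subst_inj F_torus[OF t(1) j(1)] F_torus[OF t(2) j(1)] by simp
qed

end

theorem theorem6p7:
  fixes n :: nat
    and d :: "nat \<Rightarrow> int"
    and B0 \<Lambda> :: "nat \<Rightarrow> nat \<Rightarrow> int"
    and t0 :: "nat list"
    and v :: "'f::division_ring"
    and \<Lambda>L :: "'l::ab_group_add \<Rightarrow> 'l \<Rightarrow> int"
    and X :: "'l \<Rightarrow> 'f"
    and M :: "nat list \<Rightarrow> ivec \<Rightarrow> 'f"
    and \<Lambda>M :: "nat list \<Rightarrow> ivec \<Rightarrow> ivec \<Rightarrow> int"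
    and B :: "nat list \<Rightarrow> nat \<Rightarrow> nat \<Rightarrow> int"
    and g :: "nat list \<Rightarrow> nat \<Rightarrow> ivec"
    and w :: "'k::division_ring"
    and Z :: "nat \<Rightarrow> 'k"
    and F :: "nat list \<Rightarrow> nat \<Rightarrow> 'k"
  assumes d_pos: "\<forall>i\<in>{1..n}. d i > 0"
    and B0_skew: "\<forall>i\<in>{1..n}. \<forall>j\<in>{1..n}. d i * B0 i j = - (d j * B0 j i)"
    and \<Lambda>_skew: "\<forall>i\<in>{1..n}. \<forall>j\<in>{1..n}. \<Lambda> i j = - \<Lambda> j i"
    and t0: "t0 \<in> tree_vertices n"
    and pattern: "principal_quantum_pattern v \<Lambda>L X n d B0 \<Lambda> t0 M \<Lambda>M B"
    and g_vectors: "is_g_vectors n B0 t0 g"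
    and R: "torus_skew_field n d B0 w Z"
    and F_polynomials: "is_quantum_F_polynomials n d B0 t0 w Z v M B g F"
  shows "(\<forall>j\<in>{1..n}. F t0 j = 1)
    \<and> (\<forall>k t t'. tree_edge n k t t' \<longrightarrow>
         (\<forall>j\<in>{1..n}. j \<noteq> k \<longrightarrow> F t' j = F t j)
       \<and> (let L = torus_L n d B0 w Z;
              \<rho> = rho_exponent n (B t) (rho_entry \<Lambda>M t0 g t) k;
              lam = lambda_exponent n d (B t) (g t' k) k;
              Fhat = F_hat L (B t) (g t) (F t) k;
              Finv = F_hat_inv L (g t) (F t) k
          in F t' k =
               q_power w (\<rho> 1 - lam 1) * Finv
                 * prod_list (map (Fhat 1) [1..<Suc n])
                 * torus_monomial n d B0 w Z
                     (\<Sum>l\<in>{1..n}. vscale (pos_part (B t (n + l) k)) (unit_vec l))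
             + q_power w (\<rho> (-1) - lam (-1)) * Finv
                 * prod_list (map (Fhat (-1)) [1..<Suc n])
                 * torus_monomial n d B0 w Z
                     (\<Sum>l\<in>{1..n}. vscale (pos_part (- B t (n + l) k)) (unit_vec l))))"
proof -
  interpret principal_quantum_cluster n d B0 \<Lambda> t0 v \<Lambda>L X M \<Lambda>M B g w Z F
    using d_pos B0_skew t0 pattern g_vectors R F_polynomials by unfold_locales
  have exponents: "Z_exponent t k 1 = (\<Sum>l\<in>{1..n}. vscale (pos_part (B t (n + l) k)) (unit_vec l))"
    "Z_exponent t k (-1) = (\<Sum>l\<in>{1..n}. vscale (pos_part (- B t (n + l) k)) (unit_vec l))" for t k
    by (simp_all add: Z_exponent_def)
  show ?thesis
    unfolding Let_def q_power_exponent exponents[symmetric]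
    using F_initial F_mutate_other F_recurrence by blast
qed

end
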